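(* For every fixed constant $r\ge1$, the problem $r$-DV ($r$-SP-AV control by deleting votes, with no restriction on the votes) is fixed-parameter tractable with respect to the parameter $R$, the maximum number of deleted votes.
   Context: An $r$-SP-AV election consists of a finite set of candidates and a finite multiset of votes, each vote being a linear order over all candidates. Each vote gives 1 point to each of the $r$ candidates in its top $r$ positions and 0 points to all others; the score of a candidate is its total number of points. A candidate is the unique winner if its score is strictly larger than that of every other candidate. Problem $r$-DV: Input: candidate set $\mathcal{C}\cup\{p\}$ with distinguished candidate $p$, a multiset $\Pi_{\mathcal{V}}$ of votes, and an integer $0\le R\le|\Pi_{\mathcal{V}}|$. Question: is there a submultiset $\Pi_{\mathcal{T}}$ of $\Pi_{\mathcal{V}}$ with at most $R$ votes such that $p$ is the unique winner of the election with votes $\Pi_{\mathcal{V}}\ominus\Pi_{\mathcal{T}}$? Fixed-parameter tractable means solvable in time $g(R)\cdot|I|^{O(1)}$ for a computable function $g$, where $|I|$ is the input size. *)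

theory Defs
  imports Main "HOL-Library.Multiset"
begin

text \<open>Votes are linear orders over the candidate set, represented as lists
(first element = most preferred). An election is given by its candidate set and
a multiset of votes.\<close>

definition sp_score :: "nat \<Rightarrow> 'a list multiset \<Rightarrow> 'a \<Rightarrow> nat" where
  "sp_score r V c = size (filter_mset (\<lambda>v. c \<in> set (take r v)) V)"

definition unique_winner :: "nat \<Rightarrow> 'a set \<Rightarrow> 'a list multiset \<Rightarrow> 'a \<Rightarrow> bool" where
  "unique_winner r Cs V p \<longleftrightarrow> p \<in> Cs \<and> (\<forall>c \<in> Cs - {p}. sp_score r V c < sp_score r V p)"

definition is_vote :: "'a set \<Rightarrow> 'a list \<Rightarrow> bool" where
  "is_vote Cs v \<longleftrightarrow> distinct v \<and> set v = Cs"

definition r_DV :: "nat \<Rightarrow> 'a set \<Rightarrow> 'a \<Rightarrow> 'a list multiset \<Rightarrow> nat \<Rightarrow> bool" where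
  "r_DV r Cs p V R \<longleftrightarrow> (\<exists>T. T \<subseteq># V \<and> size T \<le> R \<and> unique_winner r Cs (V - T) p)"

definition valid_instance :: "nat \<Rightarrow> nat \<Rightarrow> nat list list \<Rightarrow> nat \<Rightarrow> bool" where
  "valid_instance m p votes R \<longleftrightarrow>
     p < m \<and> (\<forall>v \<in> set votes. is_vote {0..<m} v) \<and> R \<le> length votes"

definition encode_instance :: "nat \<Rightarrow> nat \<Rightarrow> nat list list \<Rightarrow> nat \<Rightarrow> nat list" where
  "encode_instance m p votes R = [m, p, R, length votes] @ concat votes"

datatype instr =
    LIT nat nat
  | ADD nat nat nat
  | SUB nat nat nat      (* R[i] := R[j] - R[k]  (truncated) *)
  | LOAD nat nat
  | STORE nat nat
  | JZ nat nat
  | JMP nat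
  | HALT

type_synonym config = "nat \<times> (nat \<Rightarrow> nat)"

definition halted :: "instr list \<Rightarrow> config \<Rightarrow> bool" where
  "halted P cf \<longleftrightarrow> fst cf \<ge> length P \<or> P ! fst cf = HALT"

definition step :: "instr list \<Rightarrow> config \<Rightarrow> config" where
  "step P cf = (let (pc, m) = cf in
     if halted P cf then cf else
     (case P ! pc of
        LIT i c \<Rightarrow> (pc + 1, m(i := c))
      | ADD i j k \<Rightarrow> (pc + 1, m(i := m j + m k))
      | SUB i j k \<Rightarrow> (pc + 1, m(i := m j - m k))
      | LOAD i j \<Rightarrow> (pc + 1, m(i := m (m j)))
      | STORE i j \<Rightarrow> (pc + 1, m(m i := m j))
      | JZ i l \<Rightarrow> (if m i = 0 then l else pc + 1, m)
      | JMP l \<Rightarrow> (l, m)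
      | HALT \<Rightarrow> (pc, m)))"

definition init_config :: "nat list \<Rightarrow> config" where
  "init_config xs = (0, (\<lambda>a. if a = 0 then length xs
                            else if a \<le> length xs then xs ! (a - 1) else 0))"

definition run :: "instr list \<Rightarrow> nat list \<Rightarrow> nat \<Rightarrow> config" where
  "run P xs t = (step P ^^ t) (init_config xs)"

definition halts_with :: "instr list \<Rightarrow> nat list \<Rightarrow> nat \<Rightarrow> nat \<Rightarrow> bool" where
  "halts_with P xs t out \<longleftrightarrow> halted P (run P xs t) \<and> snd (run P xs t) 0 = out"

definition computable_fun :: "(nat \<Rightarrow> nat) \<Rightarrow> bool" where
  "computable_fun g \<longleftrightarrow> (\<exists>P. \<forall>k. \<exists>t. halts_with P [k] t (g k))"

definition r_DV_FPT :: "nat \<Rightarrow> bool" where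
  "r_DV_FPT r \<longleftrightarrow>
     (\<exists>P g c. computable_fun g \<and>
        (\<forall>m p votes R. valid_instance m p votes R \<longrightarrow>
           (\<exists>t \<le> g R * length (encode_instance m p votes R) ^ c.
              halts_with P (encode_instance m p votes R) t
                (if r_DV r {0..<m} p (mset votes) R then 1 else 0))))"

end

theory Submission
  imports Defs
begin

text \<open>Deleting a vote that approves \<open>p\<close> never helps, so only other votes are deleted and the score of
\<open>p\<close> is fixed. Every rival, i.e. every candidate scoring at least as much as \<open>p\<close>, must then lose a
vote, hence a solvable instance has at most \<open>r R\<close> rivals. Two votes approving the same subset of
rivals (and \<open>p\<close>) are interchangeable, and it suffices to keep \<open>R\<close> votes of each of the at most
\<open>2 ^ (r R + 1)\<close> classes. All subsets of the kept votes are tried.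

On the unit-cost RAM, subsets are encoded as sums of superincreasing weights: an array cell indexed
by the encoding of a class counts the votes kept from it, and a deletion set is a number below
\<open>2 ^ (R * 2 ^ (r R + 1))\<close> that is decoded greedily.\<close>

section \<open>A structured language and its compilation to the RAM\<close>

text \<open>The time bound has the form \<open>g R * L ^ c\<close> without a constant factor, on a
  machine whose only arithmetic is addition and truncated subtraction. Hence a small language with
  an exact step count, and hence superincreasing weights: packing a subset is addition, unpacking it
  is comparison and subtraction. At unit cost a class code may serve directly as an array index,
  however large it is. The number of trials has to be bounded on every instance, including
  unsolvable ones with many rivals. So weights are handed out to at most \<open>r * R + 1\<close>
  rivals, the 1 accounting for \<open>p\<close>. Beyond that cap the classes may be too coarse, but
  then no solution exists anyway. Nothing is rejected explicitly: each trial is scored on all votes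
  and all candidates, so an accepted deletion set is a genuine solution, and the kernel matters for
  completeness only. The parameter function is the maximal number of trials,
  \<open>2 ^ (R * 2 ^ (r * R + 1))\<close>; all constant factors are moved into the exponent of
  \<open>L\<close>, which is possible because \<open>4 \<le> L\<close>.\<close>

datatype com =
    Skip
  | Const nat nat
  | Add nat nat nat
  | Sub nat nat nat
  | Get nat nat nat
  | Put nat nat nat
  | Seq com com (infixr ";;" 60)
  | Cond nat com com
  | Loop nat nat com

type_synonym state = "(nat \<Rightarrow> nat) \<times> (nat \<Rightarrow> nat \<Rightarrow> nat)"

definition setv :: "nat \<Rightarrow> nat \<Rightarrow> state \<Rightarrow> state" where
  "setv v x s = ((fst s)(v := x), snd s)"

definition seta :: "nat \<Rightarrow> nat \<Rightarrow> nat \<Rightarrow> state \<Rightarrow> state" where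
  "seta j i x s = (fst s, (snd s)(j := (snd s j)(i := x)))"

lemma setv_simps [simp]:
  "fst (setv v x s) = (fst s)(v := x)" "snd (setv v x s) = snd s"
  by (simp_all add: setv_def)

lemma seta_simps [simp]:
  "fst (seta j i x s) = fst s" "snd (seta j i x s) = (snd s)(j := (snd s j)(i := x))"
  by (simp_all add: seta_def)

primrec exec :: "com \<Rightarrow> state \<Rightarrow> state" where
  "exec Skip s = s"
| "exec (Const v c) s = setv v c s"
| "exec (Add v a b) s = setv v (fst s a + fst s b) s"
| "exec (Sub v a b) s = setv v (fst s a - fst s b) s"
| "exec (Get v j i) s = setv v (snd s j (fst s i)) s"
| "exec (Put j i v) s = seta j (fst s i) (fst s v) s"
| "exec (c ;; d) s = exec d (exec c s)"
| "exec (Cond v c d) s = (if fst s v = 0 then exec d s else exec c s)"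
| "exec (Loop k x c) s =
     ((\<lambda>s. setv k (fst s k - 1) (exec c s)) ^^ fst s x) (setv k (fst s x) s)"

text \<open>The exact number of machine steps of the compiled code. An array access takes 7 address
  instructions plus the access itself; the first branch of \<open>Cond\<close> pays for the test and
  for the jump over the second. A loop pays for 2 initial instructions and the last test, and in
  each round for test, \<open>LIT\<close>, \<open>SUB\<close> and \<open>JMP\<close>.\<close>

primrec cost :: "com \<Rightarrow> state \<Rightarrow> nat" where
  "cost Skip s = 0"
| "cost (Const v c) s = 1"
| "cost (Add v a b) s = 1"
| "cost (Sub v a b) s = 1"
| "cost (Get v j i) s = 8"
| "cost (Put j i v) s = 8"
| "cost (c ;; d) s = cost c s + cost d (exec c s)"
| "cost (Cond v c d) s = (if fst s v = 0 then 1 + cost d s else 2 + cost c s)"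
| "cost (Loop k x c) s =
     3 + (\<Sum>i<fst s x. 4 + cost c
        (((\<lambda>s. setv k (fst s k - 1) (exec c s)) ^^ i) (setv k (fst s x) s)))"

primrec wvars :: "com \<Rightarrow> nat set" where
  "wvars Skip = {}"
| "wvars (Const v c) = {v}"
| "wvars (Add v a b) = {v}"
| "wvars (Sub v a b) = {v}"
| "wvars (Get v j i) = {v}"
| "wvars (Put j i v) = {}"
| "wvars (c ;; d) = wvars c \<union> wvars d"
| "wvars (Cond v c d) = wvars c \<union> wvars d"
| "wvars (Loop k x c) = insert k (wvars c)"

primrec warrs :: "com \<Rightarrow> nat set" where
  "warrs Skip = {}"
| "warrs (Const v c) = {}"
| "warrs (Add v a b) = {}"
| "warrs (Sub v a b) = {}"
| "warrs (Get v j i) = {}"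
| "warrs (Put j i v) = {j}"
| "warrs (c ;; d) = warrs c \<union> warrs d"
| "warrs (Cond v c d) = warrs c \<union> warrs d"
| "warrs (Loop k x c) = warrs c"

text \<open>A compiled loop stops when \<open>k\<close> reaches 0, whereas \<open>exec\<close> fixes
  the number of rounds on entry; \<open>k \<notin> wvars c\<close> makes the two agree.\<close>

primrec wf_com :: "com \<Rightarrow> bool" where
  "wf_com Skip \<longleftrightarrow> True"
| "wf_com (Const v c) \<longleftrightarrow> v < 30"
| "wf_com (Add v a b) \<longleftrightarrow> v < 30 \<and> a < 30 \<and> b < 30"
| "wf_com (Sub v a b) \<longleftrightarrow> v < 30 \<and> a < 30 \<and> b < 30"
| "wf_com (Get v j i) \<longleftrightarrow> v < 30 \<and> j < 32 \<and> i < 30"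
| "wf_com (Put j i v) \<longleftrightarrow> v < 30 \<and> j < 32 \<and> i < 30"
| "wf_com (c ;; d) \<longleftrightarrow> wf_com c \<and> wf_com d"
| "wf_com (Cond v c d) \<longleftrightarrow> v < 30 \<and> wf_com c \<and> wf_com d"
| "wf_com (Loop k x c) \<longleftrightarrow> k < 30 \<and> x < 30 \<and> k \<notin> wvars c \<and> wf_com c"

section \<open>Frame properties and the loop rule\<close>

lemma frame_var: "v \<notin> wvars c \<Longrightarrow> fst (exec c s) v = fst s v"
proof (induction c arbitrary: s)
  case (Loop k x c)
  have "fst (((\<lambda>s. setv k (fst s k - 1) (exec c s)) ^^ n) s') v = fst s' v" for n s'
    by (induction n) (use Loop in auto)
  then show ?case using Loop.prems by simp
qed auto

lemma frame_arr: "j \<notin> warrs c \<Longrightarrow> snd (exec c s) j = snd s j"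
proof (induction c arbitrary: s)
  case (Loop k x c)
  have "snd (((\<lambda>s. setv k (fst s k - 1) (exec c s)) ^^ n) s') j = snd s' j" for n s'
    by (induction n) (use Loop in auto)
  then show ?case using Loop.prems by simp
qed auto

text \<open>The step case is handed the counter value and everything the body cannot change, so the
  invariants used later mention only what is written. The counter descends from \<open>N\<close> in
  the first round to 1 in the last.\<close>

lemma Loop_invariant:
  assumes k: "k \<notin> wvars c" and N: "fst s x = N"
    and init: "P 0 (setv k N s)"
    and step: "\<And>i s'. \<lbrakk>i < N; P i s'; fst s' k = N - i;
        \<And>v. v \<notin> insert k (wvars c) \<Longrightarrow> fst s' v = fst s v;
        \<And>j. j \<notin> warrs c \<Longrightarrow> snd s' j = snd s j\<rbrakk>
      \<Longrightarrow> P (Suc i) (setv k (N - Suc i) (exec c s'))"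
  shows "P N (exec (Loop k x c) s)"
proof -
  let ?f = "\<lambda>s. setv k (fst s k - 1) (exec c s)"
  have "i \<le> N \<Longrightarrow> P i ((?f ^^ i) (setv k N s)) \<and> fst ((?f ^^ i) (setv k N s)) k = N - i
     \<and> (\<forall>v. v \<notin> insert k (wvars c) \<longrightarrow> fst ((?f ^^ i) (setv k N s)) v = fst s v)
     \<and> (\<forall>j. j \<notin> warrs c \<longrightarrow> snd ((?f ^^ i) (setv k N s)) j = snd s j)" for i
  proof (induction i)
    case 0
    then show ?case using init by simp
  next
    case (Suc i)
    let ?s = "(?f ^^ i) (setv k N s)"
    have "fst ?s k = N - i" "P i ?s" "i < N"
      and "\<And>v. v \<notin> insert k (wvars c) \<Longrightarrow> fst ?s v = fst s v"
      and "\<And>j. j \<notin> warrs c \<Longrightarrow> snd ?s j = snd s j"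
      using Suc by auto
    moreover from this have "P (Suc i) (setv k (N - Suc i) (exec c ?s))"
      by (intro step) auto
    ultimately show ?case
      by (simp add: frame_var frame_arr)
  qed
  from this[of N] show ?thesis using N by simp
qed

section \<open>Bounding the cost by the values of the loop bounds\<close>

primrec bvars :: "com \<Rightarrow> nat set" where
  "bvars Skip = {}"
| "bvars (Const v c) = {}"
| "bvars (Add v a b) = {}"
| "bvars (Sub v a b) = {}"
| "bvars (Get v j i) = {}"
| "bvars (Put j i v) = {}"
| "bvars (c ;; d) = bvars c \<union> bvars d"
| "bvars (Cond v c d) = bvars c \<union> bvars d"
| "bvars (Loop k x c) = insert x (bvars c)"

primrec cost_bound :: "com \<Rightarrow> (nat \<Rightarrow> nat) \<Rightarrow> nat" where
  "cost_bound Skip \<sigma> = 0"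
| "cost_bound (Const v c) \<sigma> = 1"
| "cost_bound (Add v a b) \<sigma> = 1"
| "cost_bound (Sub v a b) \<sigma> = 1"
| "cost_bound (Get v j i) \<sigma> = 8"
| "cost_bound (Put j i v) \<sigma> = 8"
| "cost_bound (c ;; d) \<sigma> = cost_bound c \<sigma> + cost_bound d \<sigma>"
| "cost_bound (Cond v c d) \<sigma> = 2 + cost_bound c \<sigma> + cost_bound d \<sigma>"
| "cost_bound (Loop k x c) \<sigma> = 3 + \<sigma> x * (4 + cost_bound c \<sigma>)"

text \<open>If no variable bounding a loop is assigned in \<open>c\<close>, each loop runs as often
  as its bound says on entry to \<open>c\<close>. The search is bounded by \<open>vNum\<close>,
  which the kernel computes, so kernel and search have to be estimated separately.\<close>

lemma cost_le_cost_bound: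
  assumes "bvars c \<inter> wvars c = {}" "\<And>v. v \<in> bvars c \<Longrightarrow> fst s v = \<sigma> v"
  shows "cost c s \<le> cost_bound c \<sigma>"
  using assms
proof (induction c arbitrary: s)
  case (Seq c d)
  have "cost c s \<le> cost_bound c \<sigma>" using Seq.prems by (intro Seq.IH) auto
  moreover have "cost d (exec c s) \<le> cost_bound d \<sigma>"
  proof (intro Seq.IH)
    fix v assume v: "v \<in> bvars d"
    then have "v \<notin> wvars c" using Seq.prems(1) by auto
    then show "fst (exec c s) v = \<sigma> v" using Seq.prems(2) v by (simp add: frame_var)
  qed (use Seq.prems in auto)
  ultimately show ?case by simp
next
  case (Cond v c d)
  have "cost c s \<le> cost_bound c \<sigma>" "cost d s \<le> cost_bound d \<sigma>"
    using Cond.prems by (auto intro!: Cond.IH)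
  then show ?case by auto
next
  case (Loop k x c)
  let ?f = "\<lambda>s. setv k (fst s k - 1) (exec c s)"
  have frame: "fst ((?f ^^ i) (setv k (fst s x) s)) v = fst s v" if "v \<in> bvars c" for i v
  proof -
    have "v \<noteq> k" "v \<notin> wvars c" using Loop.prems that by auto
    then show ?thesis by (induction i) (auto simp: frame_var)
  qed
  have "(\<Sum>i<fst s x. 4 + cost c ((?f ^^ i) (setv k (fst s x) s))) \<le> (\<Sum>i<fst s x. 4 + cost_bound c \<sigma>)"
  proof (intro sum_mono add_left_mono Loop.IH)
    fix i v assume "v \<in> bvars c"
    then show "fst ((?f ^^ i) (setv k (fst s x) s)) v = \<sigma> v"
      using frame[of v i] Loop.prems(2)[of v] by simp
  qed (use Loop.prems in auto)
  then show ?case using Loop.prems(2) by simp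
qed auto

lemma cost_bound_mono:
  "(\<And>v. v \<in> bvars c \<Longrightarrow> \<sigma> v \<le> \<tau> v) \<Longrightarrow> cost_bound c \<sigma> \<le> cost_bound c \<tau>"
proof (induction c)
  case (Loop k x c)
  then show ?case by (auto intro!: mult_le_mono)
next
  case (Seq c d)
  then show ?case by (auto intro!: add_mono)
next
  case (Cond v c d)
  then show ?case by (auto intro!: add_mono)
qed auto

section \<open>Compilation and its correctness\<close>

primrec code_size :: "com \<Rightarrow> nat" where
  "code_size Skip = 0"
| "code_size (Const v c) = 1"
| "code_size (Add v a b) = 1"
| "code_size (Sub v a b) = 1"
| "code_size (Get v j i) = 8"
| "code_size (Put j i v) = 8"
| "code_size (c ;; d) = code_size c + code_size d"
| "code_size (Cond v c d) = code_size c + code_size d + 2"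
| "code_size (Loop k x c) = code_size c + 6"

text \<open>Memory layout: variable \<open>v < 30\<close> lives at address \<open>v\<close>, the addresses 30 and 31 are scratch
space for compiled code, and the arrays are interleaved modulo 32 so that none of them is bounded.\<close>

definition addr :: "nat \<Rightarrow> nat \<Rightarrow> nat" where
  "addr j i = 32 * (i + 1) + j"

text \<open>There is no multiplication: five doublings produce 32 times the index, and the constant
  \<open>32 + j\<close> supplies the rest.\<close>

definition addr_code :: "nat \<Rightarrow> nat \<Rightarrow> instr list" where
  "addr_code j i = [ADD 31 i i, ADD 31 31 31, ADD 31 31 31, ADD 31 31 31, ADD 31 31 31,
     LIT 30 (32 + j), ADD 31 31 30]"

primrec compile :: "com \<Rightarrow> nat \<Rightarrow> instr list" where
  "compile Skip l = []"
| "compile (Const v c) l = [LIT v c]"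
| "compile (Add v a b) l = [ADD v a b]"
| "compile (Sub v a b) l = [SUB v a b]"
| "compile (Get v j i) l = addr_code j i @ [LOAD v 31]"
| "compile (Put j i v) l = addr_code j i @ [STORE 31 v]"
| "compile (c ;; d) l = compile c l @ compile d (l + code_size c)"
| "compile (Cond v c d) l =
     JZ v (l + code_size c + 2) # compile c (l + 1) @
     JMP (l + code_size c + code_size d + 2) # compile d (l + code_size c + 2)"
| "compile (Loop k x c) l =
     [LIT 30 0, ADD k x 30, JZ k (l + code_size c + 6)] @ compile c (l + 3) @
     [LIT 30 1, SUB k k 30, JMP (l + 2)]"

lemma length_compile [simp]: "length (compile c l) = code_size c"
  by (induction c arbitrary: l) (auto simp: addr_code_def)

definition rel :: "state \<Rightarrow> (nat \<Rightarrow> nat) \<Rightarrow> bool" where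
  "rel s M \<longleftrightarrow> (\<forall>v<30. M v = fst s v) \<and> (\<forall>j<32. \<forall>i. M (addr j i) = snd s j i)"

lemma addr_ge [simp]: "v < 32 \<Longrightarrow> addr j i \<noteq> v" "v < 32 \<Longrightarrow> v \<noteq> addr j i"
  by (auto simp: addr_def)

lemma addr_inject [simp]:
  assumes "j < 32" "j' < 32"
  shows "addr j i = addr j' i' \<longleftrightarrow> j = j' \<and> i = i'"
proof
  assume e: "addr j i = addr j' i'"
  have "addr j i mod 32 = j" "addr j' i' mod 32 = j'"
    using assms unfolding addr_def by (subst mod_mult_self4; simp)+
  with e have "j = j'" by simp
  with e show "j = j' \<and> i = i'" by (simp add: addr_def)
qed simp

lemma rel_var: "rel s M \<Longrightarrow> v < 30 \<Longrightarrow> M v = fst s v"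
  by (simp add: rel_def)

lemma rel_setv:
  assumes "rel s M" "v < 30" "x' = x"
  shows "rel (setv v x s) (M(v := x'))"
  using assms by (auto simp: rel_def)

lemma rel_temp: "rel s M \<Longrightarrow> v = 30 \<or> v = 31 \<Longrightarrow> rel s (M(v := x))"
  by (auto simp: rel_def)

lemma rel_seta: "rel s M \<Longrightarrow> j < 32 \<Longrightarrow> x' = x \<Longrightarrow> rel (seta j i x s) (M(addr j i := x'))"
  by (auto simp: rel_def)

definition runs :: "instr list \<Rightarrow> config \<Rightarrow> nat \<Rightarrow> config \<Rightarrow> bool" where
  "runs P cf t cf' \<longleftrightarrow> (step P ^^ t) cf = cf'"

lemma runs_0: "runs P cf 0 cf" by (simp add: runs_def)

lemma runs_trans: "runs P a t b \<Longrightarrow> runs P b u c \<Longrightarrow> runs P a (t + u) c"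
  unfolding runs_def by (subst add.commute) (simp add: funpow_add)

lemma runs_Suc: "step P a = b \<Longrightarrow> runs P b t c \<Longrightarrow> runs P a (Suc t) c"
  unfolding runs_def by (simp add: funpow_swap1)

lemma runs_step: "step P a = b \<Longrightarrow> runs P a 1 b"
  unfolding runs_def by simp

definition code_at :: "instr list \<Rightarrow> nat \<Rightarrow> instr list \<Rightarrow> bool" where
  "code_at P l c \<longleftrightarrow> l + length c \<le> length P \<and> (\<forall>i<length c. P ! (l + i) = c ! i)"

lemma code_at_Nil [simp]: "code_at P l [] \<longleftrightarrow> l \<le> length P"
  by (simp add: code_at_def)

lemma code_at_Cons [simp]: 
  "code_at P l (x # c) \<longleftrightarrow> l < length P \<and> P ! l = x \<and> code_at P (Suc l) c"
  by (auto simp: code_at_def less_Suc_eq_0_disj)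

lemma code_at_append [simp]:
  "code_at P l (c @ d) \<longleftrightarrow> code_at P l c \<and> code_at P (l + length c) d"
proof (induction c arbitrary: l)
  case Nil
  then show ?case by (auto simp: code_at_def)
qed simp

lemma code_at_whole: "code_at (c @ d @ e) (length c) d"
  by (auto simp: code_at_def nth_append)

lemma step_LIT: "l < length P \<Longrightarrow> P ! l = LIT i c \<Longrightarrow> step P (l, M) = (Suc l, M(i := c))"
  and step_ADD: "l < length P \<Longrightarrow> P ! l = ADD i j k \<Longrightarrow> step P (l, M) = (Suc l, M(i := M j + M k))"
  and step_SUB: "l < length P \<Longrightarrow> P ! l = SUB i j k \<Longrightarrow> step P (l, M) = (Suc l, M(i := M j - M k))"
  and step_LOAD: "l < length P \<Longrightarrow> P ! l = LOAD i j \<Longrightarrow> step P (l, M) = (Suc l, M(i := M (M j)))"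
  and step_STORE: "l < length P \<Longrightarrow> P ! l = STORE i j \<Longrightarrow> step P (l, M) = (Suc l, M(M i := M j))"
  and step_JZ: "l < length P \<Longrightarrow> P ! l = JZ i l' \<Longrightarrow> step P (l, M) = (if M i = 0 then l' else Suc l, M)"
  and step_JMP: "l < length P \<Longrightarrow> P ! l = JMP l' \<Longrightarrow> step P (l, M) = (l', M)"
  by (simp_all add: step_def halted_def)

lemmas step_simps = step_LIT step_ADD step_SUB step_LOAD step_STORE step_JZ step_JMP

fun straight :: "instr \<Rightarrow> bool" where
  "straight (JZ _ _) = False"
| "straight (JMP _) = False"
| "straight HALT = False"
| "straight _ = True"

fun effect :: "instr \<Rightarrow> (nat \<Rightarrow> nat) \<Rightarrow> nat \<Rightarrow> nat" where
  "effect (LIT i c) M = M(i := c)"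
| "effect (ADD i j k) M = M(i := M j + M k)"
| "effect (SUB i j k) M = M(i := M j - M k)"
| "effect (LOAD i j) M = M(i := M (M j))"
| "effect (STORE i j) M = M(M i := M j)"
| "effect _ M = M"

lemma runs_straight:
  assumes "code_at P l is" "list_all straight is"
  shows "runs P (l, M) (length is) (l + length is, fold effect is M)"
  using assms
proof (induction "is" arbitrary: l M)
  case (Cons a "is")
  have "step P (l, M) = (Suc l, effect a M)"
    using Cons.prems by (cases a) (simp_all add: step_simps)
  moreover have "runs P (Suc l, effect a M) (length is) (Suc l + length is, fold effect is (effect a M))"
    using Cons.prems by (intro Cons.IH) auto
  ultimately show ?case by (simp add: runs_Suc)
qed (simp add: runs_0)

lemma runs_addr_code:
  assumes "code_at P l (addr_code j i)" "i < 30"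
  shows "\<exists>M'. runs P (l, M) 7 (l + 7, M') \<and> M' 31 = addr j (M i) \<and> (\<forall>v. v \<noteq> 30 \<and> v \<noteq> 31 \<longrightarrow> M' v = M v)"
proof -
  have "runs P (l, M) 7 (l + 7, fold effect (addr_code j i) M)"
    using runs_straight[OF assms(1), of M] by (simp add: addr_code_def eval_nat_numeral)
  moreover have "fold effect (addr_code j i) M 31 = addr j (M i)"
    using assms(2) by (simp add: addr_code_def addr_def)
  moreover have "fold effect (addr_code j i) M v = M v" if "v \<noteq> 30" "v \<noteq> 31" for v
    using that by (simp add: addr_code_def)
  ultimately show ?thesis by blast
qed

lemma compile_correct:
  assumes "code_at P l (compile c l)" "wf_com c" "rel s M"
  shows "\<exists>M'. runs P (l, M) (cost c s) (l + code_size c, M') \<and> rel (exec c s) M'"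
  using assms
proof (induction c arbitrary: l s M)
  case Skip
  then show ?case by (auto intro: runs_0)
next
  case (Const v c)
  then have "step P (l, M) = (l + 1, M(v := c))" by (subst step_LIT) auto
  moreover have "rel (exec (Const v c) s) (M(v := c))" using Const by (simp add: rel_setv)
  ultimately show ?case using runs_step by fastforce
next
  case (Add v a b)
  then have "step P (l, M) = (l + 1, M(v := M a + M b))" by (subst step_ADD) auto
  moreover have "rel (exec (Add v a b) s) (M(v := M a + M b))" using Add by (simp add: rel_setv rel_var)
  ultimately show ?case using runs_step by fastforce
next
  case (Sub v a b)
  then have "step P (l, M) = (l + 1, M(v := M a - M b))" by (subst step_SUB) auto
  moreover have "rel (exec (Sub v a b) s) (M(v := M a - M b))" using Sub by (simp add: rel_setv rel_var)
  ultimately show ?case using runs_step by fastforce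
next
  case (Get v j i)
  then obtain M' where M': "runs P (l, M) 7 (l + 7, M')" "M' 31 = addr j (M i)"
    "\<And>v. v \<noteq> 30 \<Longrightarrow> v \<noteq> 31 \<Longrightarrow> M' v = M v"
    using runs_addr_code[of P l j i M] by auto
  have "length (addr_code j i) = 7" by (simp add: addr_code_def)
  then have "step P (l + 7, M') = (l + 8, M'(v := M' (M' 31)))"
    using Get.prems(1) by (subst step_LOAD[of _ P v 31]) auto
  from runs_trans[OF M'(1) runs_step[OF this]]
  have "runs P (l, M) 8 (l + 8, M'(v := M' (M' 31)))" by simp
  moreover have "rel s M'" using M' Get.prems(3) by (auto simp: rel_def)
  then have "rel (exec (Get v j i) s) (M'(v := M' (M' 31)))"
    using Get.prems M' by (auto intro!: rel_setv simp: rel_def)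
  ultimately show ?case by auto
next
  case (Put j i v)
  then obtain M' where M': "runs P (l, M) 7 (l + 7, M')" "M' 31 = addr j (M i)"
    "\<And>v. v \<noteq> 30 \<Longrightarrow> v \<noteq> 31 \<Longrightarrow> M' v = M v"
    using runs_addr_code[of P l j i M] by auto
  have "length (addr_code j i) = 7" by (simp add: addr_code_def)
  then have "step P (l + 7, M') = (l + 8, M'(M' 31 := M' v))"
    using Put.prems(1) by (subst step_STORE[of _ P 31 v]) auto
  from runs_trans[OF M'(1) runs_step[OF this]]
  have "runs P (l, M) 8 (l + 8, M'(M' 31 := M' v))" by simp
  moreover have "rel s M'" using M' Put.prems(3) by (auto simp: rel_def)
  then have "rel (exec (Put j i v) s) (M'(M' 31 := M' v))"
    using Put.prems M' rel_var[OF Put.prems(3)] by (auto intro!: rel_seta)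
  ultimately show ?case by auto
next
  case (Seq c d)
  obtain M' where M': "runs P (l, M) (cost c s) (l + code_size c, M')" "rel (exec c s) M'"
    using Seq.IH(1)[of l s M] Seq.prems by auto
  obtain M'' where "runs P (l + code_size c, M') (cost d (exec c s)) (l + code_size c + code_size d, M'')"
    "rel (exec d (exec c s)) M''"
    using Seq.IH(2)[of "l + code_size c" "exec c s" M'] Seq.prems M' by auto
  then show ?case using runs_trans[OF M'(1)] by (auto simp: add.assoc)
next
  case (Cond v c d)
  then have jz: "step P (l, M) = (if fst s v = 0 then l + code_size c + 2 else Suc l, M)"
    by (subst step_JZ[of _ P v]) (auto simp: rel_var)
  show ?case
  proof (cases "fst s v = 0")
    case True
    obtain M' where "runs P (l + code_size c + 2, M) (cost d s) (l + code_size c + 2 + code_size d, M')"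
      "rel (exec d s) M'"
      using Cond.IH(2)[of "l + code_size c + 2" s M] Cond.prems by auto
    then show ?thesis using True runs_Suc[OF jz] by (auto simp: ac_simps)
  next
    case False
    obtain M' where M': "runs P (Suc l, M) (cost c s) (Suc l + code_size c, M')" "rel (exec c s) M'"
      using Cond.IH(1)[of "Suc l" s M] Cond.prems by auto
    have "step P (Suc l + code_size c, M') = (l + code_size c + code_size d + 2, M')"
      using Cond.prems by (subst step_JMP) auto
    from runs_trans[OF M'(1) runs_step[OF this]]
    have "runs P (l, M) (Suc (cost c s + 1)) (l + code_size c + code_size d + 2, M')"
      using False by (intro runs_Suc[OF jz]) simp
    then show ?thesis using False M'(2) by (auto simp: ac_simps)
  qed
next
  case (Loop k x c)
  let ?f = "\<lambda>s. setv k (fst s k - 1) (exec c s)"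
  let ?e = "l + code_size c + 6"
  have k: "k < 30" "x < 30" "k \<notin> wvars c" using Loop.prems by auto
  have init: "runs P (l, M) 2 (l + 2, M(30 := 0, k := M x))"
  proof -
    have "step P (l, M) = (Suc l, M(30 := 0))"
      using Loop.prems by (subst step_LIT) auto
    moreover have "step P (Suc l, M(30 := 0)) = (l + 2, M(30 := 0, k := M x))"
      using Loop.prems by (subst step_ADD[of _ P k x 30]) auto
    ultimately show ?thesis using runs_Suc[OF _ runs_step] by (simp add: numeral_2_eq_2)
  qed
  have jz: "step P (l + 2, M') = (if fst s' k = 0 then ?e else l + 3, M')" if "rel s' M'" for s' M'
    using that Loop.prems by (subst step_JZ[of _ P k]) (auto simp: rel_var numeral_2_eq_2 numeral_3_eq_3)
  \<comment> \<open>Claimed from the loop test on, for any state whose counter is \<open>n\<close>,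
    so that one round leads back to the same claim with a smaller \<open>n\<close>. The leading 1 is
    the final test, which leaves the loop.\<close>
  have iter: "\<exists>M''. runs P (l + 2, M') (1 + (\<Sum>i<n. 4 + cost c ((?f ^^ i) s'))) (?e, M'')
      \<and> rel ((?f ^^ n) s') M''" if "rel s' M'" "fst s' k = n" for s' M' n
    using that
  proof (induction n arbitrary: s' M')
    case 0
    then show ?case using runs_step[OF jz[OF 0(1)]] by auto
  next
    case (Suc n)
    obtain M1 where M1: "runs P (l + 3, M') (cost c s') (l + 3 + code_size c, M1)" "rel (exec c s') M1"
      using Loop.IH[of "l + 3" s' M'] Loop.prems Suc.prems by (auto simp: numeral_3_eq_3)
    define M2 where "M2 = M1(30 := 1, k := M1 k - 1)"
    have rel2: "rel (?f s') M2"
      unfolding M2_def using k M1(2)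
      by (intro rel_setv rel_temp) (auto simp: rel_var frame_var)
    have l: "l + code_size c + 5 < length P" "P ! (l + 3 + code_size c) = LIT 30 1"
      "P ! (Suc (l + 3 + code_size c)) = SUB k k 30" "P ! (Suc (Suc (l + 3 + code_size c))) = JMP (l + 2)"
      using Loop.prems by (auto simp: numeral_3_eq_3)
    have "step P (l + 3 + code_size c, M1) = (Suc (l + 3 + code_size c), M1(30 := 1))"
      using l by (subst step_LIT) auto
    moreover have "step P (Suc (l + 3 + code_size c), M1(30 := 1)) = (Suc (Suc (l + 3 + code_size c)), M2)"
      unfolding M2_def using l k by (subst step_SUB) auto
    moreover have "step P (Suc (Suc (l + 3 + code_size c)), M2) = (l + 2, M2)"
      using l by (subst step_JMP) auto
    ultimately have "runs P (l + 3 + code_size c, M1) (Suc (Suc 1)) (l + 2, M2)"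
      by (intro runs_Suc[OF _ runs_Suc[OF _ runs_step]])
    from runs_trans[OF M1(1) this]
    have body: "runs P (l + 2, M') (Suc (cost c s' + Suc (Suc 1))) (l + 2, M2)"
      using Suc.prems by (intro runs_Suc[OF jz[OF Suc.prems(1)]]) simp
    have "fst (?f s') k = n" using Suc.prems by simp
    from Suc.IH[OF rel2 this] obtain M3 where
      M3: "runs P (l + 2, M2) (1 + (\<Sum>i<n. 4 + cost c ((?f ^^ i) (?f s')))) (?e, M3)"
      "rel ((?f ^^ n) (?f s')) M3" by blast
    \<comment> \<open>The machine performs the first round first, while the sum and
      \<open>funpow\<close> unfold at the last one; hence the shift.\<close>
    have sum: "(\<Sum>i<Suc n. 4 + cost c ((?f ^^ i) s')) = 4 + cost c s' + (\<Sum>i<n. 4 + cost c ((?f ^^ i) (?f s')))"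
      by (subst sum.lessThan_Suc_shift) (simp add: funpow_Suc_right del: funpow.simps(2))
    have "Suc (cost c s' + Suc (Suc 1)) + (1 + (\<Sum>i<n. 4 + cost c ((?f ^^ i) (?f s'))))
        = 1 + (\<Sum>i<Suc n. 4 + cost c ((?f ^^ i) s'))"
      unfolding sum by simp
    from runs_trans[OF body M3(1), unfolded this] M3(2) show ?case
      by (intro exI[of _ M3] conjI) (simp_all only: funpow_Suc_right o_apply)
  qed
  have "rel (setv k (fst s x) s) (M(30 := 0, k := M x))"
    using Loop.prems by (intro rel_setv rel_temp) (auto simp: rel_var)
  from iter[OF this, of "fst s x"] obtain M' where
    "runs P (l + 2, M(30 := 0, k := M x)) (1 + (\<Sum>i<fst s x. 4 + cost c ((?f ^^ i) (setv k (fst s x) s)))) (?e, M')"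
    "rel ((?f ^^ fst s x) (setv k (fst s x) s)) M'" by auto
  from runs_trans[OF init this(1)] this(2) show ?case
    by (intro exI[of _ M']) (simp add: numeral_3_eq_3 ac_simps)
qed

section \<open>Relocating the input\<close>

text \<open>The input occupies addresses \<open>1, \<dots>, L\<close>, so only the addresses \<open>0, \<dots>, 4\<close> can be made
free at first, by saving the header \<open>m, p, R, n\<close> at address \<open>2 L\<close>. The loop then spreads every
cell \<open>q\<close> with \<open>5 \<le> q \<le> 2 L + 3\<close> out to \<open>addr 0 q\<close>, from the top downwards,
so that no cell is overwritten before it is moved.\<close>

definition save_code :: "instr list" where
  "save_code = [ADD 0 0 0, STORE 0 1, LIT 1 1, ADD 0 0 1, STORE 0 2, ADD 0 0 1, STORE 0 3,
     ADD 0 0 1, STORE 0 4, LIT 2 0, ADD 4 0 2]"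

definition move_test :: "instr list" where
  "move_test = [LIT 1 4, SUB 1 0 1]"

definition move_body :: "instr list" where
  "move_body = [ADD 1 0 0, ADD 1 1 1, ADD 1 1 1, ADD 1 1 1, ADD 1 1 1, LIT 2 32, ADD 1 1 2,
     LOAD 2 0, STORE 1 2, LIT 2 0, STORE 0 2, LIT 1 1, SUB 0 0 1]"

definition setup_code :: "instr list" where
  "setup_code = save_code @ move_test @ [JZ 1 28] @ move_body @ [JMP 11]"

lemma length_setup [simp]: "length setup_code = 28"
  by (simp add: setup_code_def save_code_def move_test_def move_body_def)

text \<open>\<open>D\<close> stands for the memory after the header is saved, \<open>j\<close> for
  the highest cell not yet moved. The last clause makes all arrays other than array 0 start out
  filled with 0; the counters and weights of the algorithm rely on this.\<close>

definition moved :: "(nat \<Rightarrow> nat) \<Rightarrow> nat \<Rightarrow> nat \<Rightarrow> (nat \<Rightarrow> nat) \<Rightarrow> bool" where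
  "moved D N j M \<longleftrightarrow> M 0 = j \<and> M 4 = N \<and>
     (\<forall>a. 5 \<le> a \<and> a \<le> j \<longrightarrow> M a = D a) \<and>
     (\<forall>q. j < q \<and> q \<le> N \<longrightarrow> M (addr 0 q) = D q) \<and>
     (\<forall>a. 5 \<le> a \<and> j < a \<and> (\<forall>q. j < q \<and> q \<le> N \<longrightarrow> a \<noteq> addr 0 q) \<longrightarrow> M a = 0)"

text \<open>Cell \<open>Suc j\<close> is copied and then cleared. As \<open>q < addr 0 q\<close>,
  the copy lands above all unmoved cells, and \<open>Suc j\<close> is not the target of any cell
  moved earlier, so neither action destroys data.\<close>

lemma moved_step:
  assumes "moved D N (Suc j) M" "4 \<le> j" "Suc j \<le> N"
  shows "moved D N j (fold effect move_body M)"
proof -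
  have j: "M 0 = Suc j" using assms by (simp add: moved_def)
  define M' where "M' = fold effect move_body M"
  have gt: "q < addr 0 q" for q by (simp add: addr_def)
  have M': "M' 0 = j" "M' 4 = M 4" "M' (addr 0 (Suc j)) = M (Suc j)" "M' (Suc j) = 0"
    "\<And>a. 5 \<le> a \<Longrightarrow> a \<noteq> addr 0 (Suc j) \<Longrightarrow> a \<noteq> Suc j \<Longrightarrow> M' a = M a"
    using assms(2) by (simp_all add: M'_def move_body_def j addr_def)
  have ge: "5 \<le> addr 0 q" for q by (simp add: addr_def)
  have "M' (addr 0 q) = D q" if "j < q" "q \<le> N" for q
  proof (cases "q = Suc j")
    case True
    then show ?thesis using assms M' by (simp add: moved_def)
  next
    case False
    then show ?thesis using assms M'(5)[of "addr 0 q"] that gt[of q] ge[of q]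
      by (auto simp: moved_def)
  qed
  moreover have "M' a = 0"
    if a: "5 \<le> a" "j < a" "\<And>q. j < q \<Longrightarrow> q \<le> N \<Longrightarrow> a \<noteq> addr 0 q" for a
  proof (cases "a = Suc j")
    case False
    then have "M' a = M a" using a M'(5)[of a] assms(3) by auto
    moreover have "M a = 0" using assms(1) a False by (auto simp: moved_def)
    ultimately show ?thesis by simp
  qed (simp add: M')
  moreover have "M' a = D a" if "5 \<le> a" "a \<le> j" for a
    using that M'(5)[of a] gt[of "Suc j"] assms(1) by (auto simp: moved_def)
  moreover have "M 4 = N" using assms(1) by (simp add: moved_def)
  ultimately show ?thesis using M' unfolding moved_def M'_def[symmetric] by auto
qed

text \<open>No register is free at first. Doubling cell 0 in place yields an address beyond the
  input and beyond the cells 0 to 4, because \<open>4 \<le> L\<close>; cell 1, once saved, can hold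
  the increment. Cell 4 keeps \<open>2 * L + 3\<close>, the place of the last header entry, from
  which the header is found again later.\<close>

lemma save_effect:
  assumes "M 0 = L" "4 \<le> L"
  shows "fold effect save_code M = M(2 * L := M 1, 2 * L + 1 := M 2, 2 * L + 2 := M 3,
    2 * L + 3 := M 4, 0 := 2 * L + 3, 1 := 1, 2 := 0, 4 := 2 * L + 3)"
proof -
  have start: "fold effect [ADD 0 0 0, STORE 0 1, LIT 1 1] M = M(2 * L := M 1, 0 := 2 * L, 1 := 1)"
    using assms by (auto simp: fun_eq_iff)
  have next_cell: "fold effect [ADD 0 0 1, STORE 0 v] (M'(0 := x, 1 := 1)) = M'(x + 1 := M' v, 0 := x + 1, 1 := 1)"
    if "4 < x" "1 < v" for M' x v
    using that by (auto simp: fun_eq_iff)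
  have n: "4 < 2 * L" "4 < 2 * L + 1" "4 < 2 * L + 2" "1 < (2::nat)" "1 < (3::nat)" "1 < (4::nat)"
    using assms(2) by simp_all
  have plus: "2 * L + 1 + 1 = 2 * L + 2" "2 * L + 2 + 1 = 2 * L + 3"
    by simp_all
  have upd: "(M(2 * L := M 1)) 2 = M 2" "(M(2 * L := M 1, 2 * L + 1 := M 2)) 3 = M 3"
    "(M(2 * L := M 1, 2 * L + 1 := M 2, 2 * L + 2 := M 3)) 4 = M 4"
    using assms(2) by simp_all
  have "save_code = [ADD 0 0 0, STORE 0 1, LIT 1 1] @ [ADD 0 0 1, STORE 0 2] @
     [ADD 0 0 1, STORE 0 3] @ [ADD 0 0 1, STORE 0 4] @ [LIT 2 0, ADD 4 0 2]"
    by (simp add: save_code_def)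
  then have "fold effect save_code M =
      fold effect [LIT 2 0, ADD 4 0 2] (M(2 * L := M 1, 2 * L + 1 := M 2, 2 * L + 2 := M 3,
        2 * L + 3 := M 4, 0 := 2 * L + 3, 1 := 1))"
    unfolding \<open>save_code = _\<close> fold_append o_apply start
    using assms(2) n by (simp only: next_cell plus upd)
  also have "\<dots> = M(2 * L := M 1, 2 * L + 1 := M 2, 2 * L + 2 := M 3,
    2 * L + 3 := M 4, 0 := 2 * L + 3, 1 := 1, 2 := 0, 4 := 2 * L + 3)"
    by (auto simp: fun_eq_iff)
  finally show ?thesis .
qed

lemma setup_correct:
  assumes xs: "length xs = L" "4 \<le> L"
  shows "\<exists>s M. runs (setup_code @ P) (init_config xs) (34 * L - 3) (28, M) \<and> rel s M \<and>
     fst s 4 = 2 * L + 3 \<and> (\<forall>t<4. snd s 0 (2 * L + t) = xs ! t) \<and>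
     (\<forall>a. 5 \<le> a \<and> a \<le> L \<longrightarrow> snd s 0 a = xs ! (a - 1)) \<and>
     (\<forall>j i. 0 < j \<and> j < 32 \<longrightarrow> snd s j i = 0)"
proof -
  let ?P = "setup_code @ P"
  let ?N = "2 * L + 3"
  define M0 where "M0 = snd (init_config xs)"
  define M1 where "M1 = fold effect save_code M0"
  define D where "D = M1"
  have init: "init_config xs = (0, M0)" by (simp add: M0_def init_config_def)
  have M0: "M0 0 = L" "M0 a = (if a \<le> L then xs ! (a - 1) else 0)" if "0 < a" for a
    using that xs by (auto simp: M0_def init_config_def)
  have M0': "M0 0 = L" "M0 (Suc 0) = xs ! 0" "M0 2 = xs ! 1" "M0 3 = xs ! 2" "M0 4 = xs ! 3"
    using M0[of "Suc 0"] M0[of 2] M0[of 3] M0[of 4] xs(2) by (simp_all add: numeral_eq_Suc)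
  have eq: "M1 = M0(2 * L := xs ! 0, 2 * L + 1 := xs ! 1, 2 * L + 2 := xs ! 2,
    2 * L + 3 := xs ! 3, 0 := ?N, 1 := 1, 2 := 0, 4 := ?N)"
    unfolding M1_def using xs(2) M0' by (subst save_effect) simp_all
  have M1: "M1 0 = ?N" "M1 4 = ?N" "M1 (2 * L) = xs ! 0" "M1 (2 * L + 1) = xs ! 1"
    "M1 (2 * L + 2) = xs ! 2" "M1 (2 * L + 3) = xs ! 3"
    using xs(2) by (simp_all add: eq)
  have M1': "M1 a = M0 a" if "5 \<le> a" "a < 2 * L \<or> 2 * L + 3 < a" for a
    using that by (auto simp: eq)
  have code: "code_at ?P 0 save_code" "code_at ?P 11 move_test" "code_at ?P 13 [JZ 1 28]"
     "code_at ?P 14 move_body" "code_at ?P 27 [JMP 11]"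
    by (auto simp: code_at_def setup_code_def save_code_def move_test_def move_body_def nth_append nth_Cons')
  have save: "runs ?P (0, M0) 11 (11, M1)"
  proof -
    have "length save_code = 11" "list_all straight save_code" by (simp_all add: save_code_def)
    then show ?thesis using runs_straight[OF code(1), of M0] by (simp add: M1_def)
  qed
  have test: "runs ?P (11, M) 3 (if M 0 - 4 = 0 then 28 else 14, M(1 := M 0 - 4))" for M
  proof -
    have "runs ?P (11, M) 2 (13, M(1 := M 0 - 4))"
      using runs_straight[OF code(2), of M] by (simp add: move_test_def eval_nat_numeral)
    from runs_trans[OF this runs_step[OF step_JZ[of _ _ 1 28]]] code(3)
    show ?thesis by (cases "M 0 \<le> 4") simp_all
  qed
  have body: "runs ?P (14, M) 14 (11, fold effect move_body M)" for M
  proof -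
    have "runs ?P (14, M) 13 (27, fold effect move_body M)"
    proof -
      have "length move_body = 13" "list_all straight move_body" by (simp_all add: move_body_def)
      then show ?thesis using runs_straight[OF code(4), of M] by simp
    qed
    from runs_trans[OF this runs_step[OF step_JMP[of _ _ 11]]] code(5)
    show ?thesis by simp
  qed
  have moved_temp: "moved D ?N j (M(1 := x))" if "moved D ?N j M" for j M x
    using that by (auto simp: moved_def)
  have loop: "\<exists>M'. runs ?P (11, M) (17 * d + 3) (28, M') \<and> moved D ?N 4 M'"
    if "moved D ?N (d + 4) M" "d + 4 \<le> ?N" for d M
    using that
  proof (induction d arbitrary: M)
    case 0
    then have "M 0 = 4" by (simp add: moved_def)
    then show ?case using test[of M] moved_temp[of 4 M] 0 by auto
  next
    case (Suc d)
    let ?M = "M(1 := M 0 - 4)"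
    have "M 0 = Suc d + 4" using Suc.prems by (simp add: moved_def)
    then have "runs ?P (11, M) 3 (14, ?M)" using test[of M] by simp
    note 1 = runs_trans[OF this body]
    have "moved D ?N (d + 4) (fold effect move_body ?M)"
      using Suc.prems by (intro moved_step moved_temp) auto
    from Suc.IH[OF this] Suc.prems(2) obtain M' where
      "runs ?P (11, fold effect move_body ?M) (17 * d + 3) (28, M')" "moved D ?N 4 M'" by auto
    with runs_trans[OF 1 this(1)] show ?case by (auto simp: algebra_simps)
  qed
  have "moved D ?N (2 * L - 1 + 4) M1"
    using xs(2) M1 M1' M0 by (auto simp: moved_def D_def)
  from loop[OF this] xs(2) obtain M where
    M: "runs ?P (11, M1) (17 * (2 * L - 1) + 3) (28, M)" "moved D ?N 4 M" by auto
  have "runs ?P (init_config xs) (34 * L - 3) (28, M)"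
  proof -
    \<comment> \<open>11 steps save the header; each of the \<open>2 * L - 1\<close> cells from 5 to
      \<open>2 * L + 3\<close> takes 3 steps for the test and 14 for the body with its jump; the
      last test takes 3.\<close>
    have "11 + (17 * (2 * L - 1) + 3) = 34 * L - 3" using xs(2) by simp
    with runs_trans[OF save M(1)] show ?thesis by (simp only: init)
  qed
  moreover have "rel (M, \<lambda>j i. M (addr j i)) M" by (simp add: rel_def)
  moreover have "M (addr 0 q) = D q" if "4 < q" "q \<le> ?N" for q
    using M(2) that by (simp add: moved_def)
  moreover have "M (addr j i) = 0" if "0 < j" "j < 32" for i j
  proof -
    have "5 \<le> addr j i" by (simp add: addr_def)
    then show ?thesis using M(2) that by (auto simp: moved_def)
  qed
  moreover have "D (2 * L + t) = xs ! t" if "t < 4" for t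
  proof -
    have "t = 0 \<or> t = 1 \<or> t = 2 \<or> t = 3" using that by auto
    then show ?thesis using M1 by (auto simp: D_def)
  qed
  moreover have "D a = xs ! (a - 1)" if "5 \<le> a" "a \<le> L" for a
    using that M1'[of a] M0[of a] by (auto simp: D_def)
  moreover have "M 4 = ?N" using M(2) by (simp add: moved_def)
  ultimately show ?thesis using xs(2)
    by (intro exI[of _ "(M, \<lambda>j i. M (addr j i))"] exI[of _ M]) auto
qed

lemma halts_with_compile:
  assumes "runs (Q @ compile c (length Q)) (init_config xs) t (length Q, M)" "rel s M" "wf_com c"
  shows "halts_with (Q @ compile c (length Q)) xs (t + cost c s) (fst (exec c s) 0)"
proof -
  let ?P = "Q @ compile c (length Q)"
  have "code_at ?P (length Q) (compile c (length Q))"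
    using code_at_whole[of Q _ "[]"] by simp
  then obtain M' where M': "runs ?P (length Q, M) (cost c s) (length Q + code_size c, M')"
    "rel (exec c s) M'"
    using compile_correct assms by blast
  then have "run ?P xs (t + cost c s) = (length ?P, M')"
    using runs_trans[OF assms(1)] by (simp add: runs_def run_def)
  then show ?thesis using M'(2) by (simp add: halts_with_def halted_def rel_def)
qed

section \<open>Computability of the parameter function\<close>

definition subset_bound_com :: "nat \<Rightarrow> com" where
  "subset_bound_com r =
     Const 2 2 ;; Const 3 r ;; 
     Loop 4 1 (Loop 5 3 (Add 2 2 2)) ;;
     Const 6 0 ;; Loop 4 1 (Add 6 6 2) ;;
     Const 0 1 ;; Loop 4 6 (Add 0 0 0)"

text \<open>Only repeated addition is available: \<open>r\<close> doublings in each of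
  \<open>k\<close> rounds lead from 2 to \<open>2 ^ (r * k + 1)\<close>, adding this
  \<open>k\<close> times gives the outer exponent, and that many doublings of 1 give the result.
  Variable 1 is the cell holding the single input number.\<close>

lemma exec_subset_bound_com: "fst (exec (subset_bound_com r) s) 0 = 2 ^ (fst s 1 * 2 ^ (r * fst s 1 + 1))"
proof -
  let ?k = "fst s 1"
  define s1 where "s1 = setv 3 r (setv 2 2 s)"
  define s2 where "s2 = exec (Loop 4 1 (Loop 5 3 (Add 2 2 2))) s1"
  define s3 where "s3 = exec (Loop 4 1 (Add 6 6 2)) (setv 6 0 s2)"
  have inner: "fst (exec (Loop 5 3 (Add 2 2 2)) t) 2 = fst t 2 * 2 ^ fst t 3" for t
    by (rule Loop_invariant[where P = "\<lambda>i u. fst u 2 = fst t 2 * 2 ^ i"]) auto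
  have "fst s2 2 = 2 * (2 ^ r) ^ ?k" unfolding s2_def
    by (rule Loop_invariant[where P = "\<lambda>i u. fst u 2 = 2 * (2 ^ r) ^ i"])
      (auto simp: s1_def inner simp del: exec.simps(9))
  then have s2: "fst s2 2 = 2 ^ (r * ?k + 1)" by (simp add: power_mult)
  have s2_1: "fst s2 1 = ?k"
    unfolding s2_def by (subst frame_var) (simp_all add: s1_def)
  have "fst s3 6 = ?k * fst s2 2" unfolding s3_def
    by (rule Loop_invariant[where P = "\<lambda>i u. fst u 6 = i * fst s2 2"])
      (auto simp: s2_1[unfolded One_nat_def])
  moreover have "fst (exec (Loop 4 6 (Add 0 0 0)) (setv 0 1 t)) 0 = 2 ^ fst t 6" for t
    by (rule Loop_invariant[where P = "\<lambda>i u. fst u 0 = 2 ^ i"]) auto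
  moreover have "exec (subset_bound_com r) s = exec (Loop 4 6 (Add 0 0 0)) (setv 0 1 s3)"
    by (simp add: subset_bound_com_def s3_def s2_def s1_def del: exec.simps(9))
  ultimately show ?thesis by (simp only: s2)
qed

lemma computable_subset_bound: "computable_fun (\<lambda>k. 2 ^ (k * 2 ^ (r * k + 1)))"
proof -
  have "\<exists>t. halts_with (compile (subset_bound_com r) 0) [k] t (2 ^ (k * 2 ^ (r * k + 1)))" for k
  proof -
    let ?M = "snd (init_config [k])" and ?Q = "[] :: instr list"
    let ?s = "(?M, \<lambda>j i. ?M (addr j i))"
    have "runs (?Q @ compile (subset_bound_com r) (length ?Q)) (init_config [k]) 0 (length ?Q, ?M)"
      by (simp add: runs_def init_config_def)
    moreover have "rel ?s ?M" by (simp add: rel_def)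
    moreover have "wf_com (subset_bound_com r)" by (simp add: subset_bound_com_def)
    ultimately have "halts_with (?Q @ compile (subset_bound_com r) (length ?Q)) [k]
        (0 + cost (subset_bound_com r) ?s) (fst (exec (subset_bound_com r) ?s) 0)"
      by (rule halts_with_compile)
    moreover have "?M 1 = k" by (simp add: init_config_def)
    ultimately show ?thesis unfolding exec_subset_bound_com by auto
  qed
  then show ?thesis unfolding computable_fun_def by blast
qed

section \<open>Superincreasing weights and the kernel\<close>

lemma length_concat_const: "\<forall>v\<in>set vs. length v = m \<Longrightarrow> length (concat vs) = length vs * m"
  by (induction vs) auto

lemma nth_concat_const:
  "\<lbrakk>\<forall>v\<in>set vs. length v = m; i < length vs; a < m\<rbrakk> \<Longrightarrow> concat vs ! (i * m + a) = vs ! i ! a"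
proof (induction vs arbitrary: i)
  case (Cons v vs)
  then show ?case by (cases i) (auto simp: nth_append add.assoc)
qed simp

lemma set_take_Suc: "k < length xs \<Longrightarrow> set (take (Suc k) xs) = insert (xs ! k) (set (take k xs))"
  by (simp add: take_Suc_conv_app_nth)

lemma nth_notin_set_take: "distinct xs \<Longrightarrow> k < length xs \<Longrightarrow> xs ! k \<notin> set (take k xs)"
  by (auto simp: in_set_conv_nth nth_eq_iff_index_eq)

text \<open>Decodes a sum of weights from the largest index downwards. Weight 0 marks an index that
  cannot be chosen: a candidate without a weight, or a vote that is not kept.\<close>

fun greedy :: "(nat \<Rightarrow> nat) \<Rightarrow> nat \<Rightarrow> nat \<Rightarrow> nat set" where
  "greedy w 0 y = {}"
| "greedy w (Suc i) y =
     (if w i \<noteq> 0 \<and> w i \<le> y then insert i (greedy w i (y - w i)) else greedy w i y)"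

lemma greedy_subset: "greedy w n y \<subseteq> {..<n}"
proof (induction n arbitrary: y)
  case (Suc n)
  show ?case using Suc[of y] Suc[of "y - w n"] by (auto simp: less_Suc_eq)
qed simp

lemma finite_greedy [simp]: "finite (greedy w k y)"
  by (rule finite_subset[OF greedy_subset]) simp

lemma not_in_greedy [simp]: "k \<notin> greedy w k y"
  using greedy_subset[of w k y] by auto

lemma greedy_zero: "(\<And>i. w i = 0) \<Longrightarrow> greedy w k y = {}"
  by (induction k) auto

text \<open>Apart from zeros the weights are 1, 2, 4, ... in the order of the indices, so subset
  sums are binary numerals over the nonzero positions.\<close>

definition superincreasing :: "(nat \<Rightarrow> nat) \<Rightarrow> nat \<Rightarrow> bool" where
  "superincreasing w n \<longleftrightarrow> (\<forall>i<n. w i = 0 \<or> w i = Suc (\<Sum>j<i. w j))"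

lemma superincreasing_Suc:
  "superincreasing w (Suc n) \<longleftrightarrow> superincreasing w n \<and> (w n = 0 \<or> w n = Suc (\<Sum>j<n. w j))"
  by (auto simp: superincreasing_def less_Suc_eq)

lemma superincreasing_cong:
  "(\<And>i. i < n \<Longrightarrow> w i = w' i) \<Longrightarrow> superincreasing w n \<longleftrightarrow> superincreasing w' n"
  by (auto simp: superincreasing_def)

text \<open>A nonzero \<open>w n\<close> exceeds the sum of all earlier weights, so comparing it
  with the current value decides whether \<open>n\<close> belongs to \<open>S\<close>.\<close>

lemma greedy_sum:
  "superincreasing w n \<Longrightarrow> S \<subseteq> {i. i < n \<and> w i \<noteq> 0} \<Longrightarrow> greedy w n (sum w S) = S"
proof (induction n arbitrary: S)
  case (Suc n)
  have w: "superincreasing w n" using Suc.prems by (simp add: superincreasing_def)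
  have "finite S" using Suc.prems(2) finite_subset[of S "{i. i < Suc n \<and> w i \<noteq> 0}"] by simp
  show ?case
  proof (cases "n \<in> S")
    case True
    have "S - {n} \<subseteq> {i. i < n \<and> w i \<noteq> 0}" using Suc.prems(2) by (auto simp: less_Suc_eq)
    then have "greedy w n (sum w (S - {n})) = S - {n}" by (rule Suc.IH[OF w])
    moreover have "sum w S = w n + sum w (S - {n})" using True \<open>finite S\<close> by (simp add: sum.remove)
    moreover have "w n \<noteq> 0" using True Suc.prems(2) by auto
    ultimately show ?thesis using True by (simp add: insert_absorb)
  next
    case False
    then have S: "S \<subseteq> {i. i < n \<and> w i \<noteq> 0}" using Suc.prems(2) by (auto simp: less_Suc_eq)
    then have "sum w S \<le> (\<Sum>j<n. w j)" by (intro sum_mono2) auto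
    moreover have "w n = 0 \<or> w n = Suc (\<Sum>j<n. w j)"
      using Suc.prems(1) unfolding superincreasing_def by blast
    ultimately have "w n = 0 \<or> \<not> w n \<le> sum w S" by linarith
    then have "greedy w (Suc n) (sum w S) = greedy w n (sum w S)" by auto
    then show ?thesis using Suc.IH[OF w S] by (rule trans)
  qed
qed simp

text \<open>The left side is the number of values to be decoded; applied to the votes it turns a
  bound on the kept votes into a bound on the trials, applied to the candidates it bounds the number
  of classes.\<close>

lemma superincreasing_total:
  "superincreasing w n \<Longrightarrow> Suc (\<Sum>j<n. w j) = 2 ^ card {i. i < n \<and> w i \<noteq> 0}"
proof (induction n)
  case (Suc n)
  have IH: "Suc (\<Sum>j<n. w j) = 2 ^ card {i. i < n \<and> w i \<noteq> 0}"
    using Suc by (simp add: superincreasing_def)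
  show ?case
  proof (cases "w n = 0")
    case True
    then have "{i. i < Suc n \<and> w i \<noteq> 0} = {i. i < n \<and> w i \<noteq> 0}" by (auto simp: less_Suc_eq)
    then show ?thesis using IH True by simp
  next
    case False
    then have "{i. i < Suc n \<and> w i \<noteq> 0} = insert n {i. i < n \<and> w i \<noteq> 0}" by (auto simp: less_Suc_eq)
    moreover have "w n = Suc (\<Sum>j<n. w j)" using False Suc.prems by (auto simp: superincreasing_def)
    ultimately show ?thesis using IH by simp
  qed
qed simp

text \<open>Elements compete only within their own class, so the injection can be built one element
  at a time: when \<open>a\<close> is added, its class in \<open>K\<close> is larger than the part
  already used up and still contains a free \<open>b\<close>.\<close>

lemma card_classes_matching:
  assumes "finite I" "finite K" "\<And>u. card {i \<in> I. f i = u} \<le> card {i \<in> K. f i = u}"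
  shows "\<exists>h. inj_on h I \<and> h ` I \<subseteq> K \<and> (\<forall>i\<in>I. f (h i) = f i)"
  using assms(1,3)
proof (induction I)
  case (insert a I)
  have "card {i \<in> I. f i = u} \<le> card {i \<in> K. f i = u}" for u
  proof -
    have "card {i \<in> I. f i = u} \<le> card {i \<in> insert a I. f i = u}"
      using insert.hyps by (intro card_mono) auto
    with insert.prems[of u] show ?thesis by simp
  qed
  from insert.IH[OF this] obtain h where
    h: "inj_on h I" "h ` I \<subseteq> K" "\<And>i. i \<in> I \<Longrightarrow> f (h i) = f i" by blast
  have "{i \<in> insert a I. f i = f a} = insert a {i \<in> I. f i = f a}" by auto
  then have "card {i \<in> I. f i = f a} < card {i \<in> K. f i = f a}"
    using insert.prems[of "f a"] insert.hyps by simp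
  then have "card (h ` {i \<in> I. f i = f a}) < card {i \<in> K. f i = f a}"
    using card_image_le[of "{i \<in> I. f i = f a}" h] insert.hyps by simp
  then obtain b where b: "b \<in> K" "f b = f a" "b \<notin> h ` {i \<in> I. f i = f a}"
    using card_mono[of "h ` {i \<in> I. f i = f a}" "{i \<in> K. f i = f a}"] insert.hyps
    by fastforce
  have "b \<notin> h ` I" using b h(3) by auto
  with insert.hyps h b have "inj_on (h(a := b)) (insert a I) \<and> (h(a := b)) ` insert a I \<subseteq> K \<and>
      (\<forall>i\<in>insert a I. f ((h(a := b)) i) = f i)"
    by (auto simp: inj_on_def)
  then show ?case by blast
qed simp

section \<open>Deletion sets and completeness of the kernel\<close>

definition remaining :: "(nat \<Rightarrow> nat set) \<Rightarrow> nat \<Rightarrow> nat set \<Rightarrow> nat \<Rightarrow> nat" where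
  "remaining tp n I c = card {i. i < n \<and> i \<notin> I \<and> c \<in> tp i}"

definition wins :: "(nat \<Rightarrow> nat set) \<Rightarrow> nat \<Rightarrow> nat \<Rightarrow> nat \<Rightarrow> nat set \<Rightarrow> bool" where
  "wins tp n m p I \<longleftrightarrow> (\<forall>c<m. c \<noteq> p \<longrightarrow> remaining tp n I c < remaining tp n I p)"

lemma remaining_add:
  assumes "I \<subseteq> {..<n}"
  shows "remaining tp n I c + card {i \<in> I. c \<in> tp i} = remaining tp n {} c"
proof -
  have "{i. i < n \<and> i \<notin> {} \<and> c \<in> tp i} = {i. i < n \<and> i \<notin> I \<and> c \<in> tp i} \<union> {i \<in> I. c \<in> tp i}"
    using assms by auto
  moreover have "finite I" using assms finite_subset by blast
  ultimately show ?thesis unfolding remaining_def by (subst card_Un_disjoint[symmetric]) auto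
qed

lemma remaining_Suc_insert: "remaining f (Suc k) (insert k G) c = remaining f k G c"
  unfolding remaining_def by (rule arg_cong[where f = card]) (auto simp: less_Suc_eq)

lemma remaining_Suc:
  assumes "k \<notin> G"
  shows "remaining f (Suc k) G c = remaining f k G c + (if c \<in> f k then 1 else 0)"
proof -
  have "{i. i < Suc k \<and> i \<notin> G \<and> c \<in> f i} =
      (if c \<in> f k then insert k {i. i < k \<and> i \<notin> G \<and> c \<in> f i} else {i. i < k \<and> i \<notin> G \<and> c \<in> f i})"
    using assms by (auto simp: less_Suc_eq)
  then show ?thesis by (simp add: remaining_def)
qed

text \<open>Putting back a vote that approves \<open>p\<close> raises the score of \<open>p\<close>
  by 1 and every other score by at most 1.\<close>

lemma wins_drop_supporters:
  assumes "wins tp n m p I" "I \<subseteq> {..<n}"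
  shows "wins tp n m p {i \<in> I. p \<notin> tp i}"
  unfolding wins_def
proof (intro allI impI)
  fix c assume c: "c < m" "c \<noteq> p"
  let ?J = "{i \<in> I. p \<notin> tp i}"
  have fin: "finite I" using assms finite_subset by blast
  have J: "?J \<subseteq> {..<n}" using assms by auto
  have "card {i \<in> I. c \<in> tp i} \<le> card ({i \<in> ?J. c \<in> tp i} \<union> {i \<in> I. p \<in> tp i})"
    using fin by (intro card_mono) auto
  also have "\<dots> \<le> card {i \<in> ?J. c \<in> tp i} + card {i \<in> I. p \<in> tp i}"
    by (rule card_Un_le)
  finally have "card {i \<in> I. c \<in> tp i} \<le> card {i \<in> ?J. c \<in> tp i} + card {i \<in> I. p \<in> tp i}" .
  moreover have "remaining tp n I c < remaining tp n I p" using assms c by (simp add: wins_def)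
  moreover have "{i \<in> ?J. p \<in> tp i} = {}" by auto
  ultimately show "remaining tp n ?J c < remaining tp n ?J p"
    using remaining_add[OF assms(2), of tp c] remaining_add[OF assms(2), of tp p]
      remaining_add[OF J, of tp c] remaining_add[OF J, of tp p] by simp
qed

text \<open>The class of vote \<open>i\<close> is encoded by \<open>sum wt (tp i)\<close>; the set \<open>rivals\<close> includes \<open>p\<close>, so that votes
of one class agree on \<open>p\<close> as well.\<close>

lemma kernel_complete:
  fixes wt W :: "nat \<Rightarrow> nat"
  assumes p: "p < m"
    and tp: "\<And>i. i < n \<Longrightarrow> tp i \<subseteq> {..<m}" "\<And>i. i < n \<Longrightarrow> card (tp i) \<le> r"
    and rivals: "rivals = {c. c < m \<and> remaining tp n {} p \<le> remaining tp n {} c}"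
    and wt: "superincreasing wt m" "card rivals \<le> r * R + 1 \<Longrightarrow> \<forall>c\<in>rivals. wt c \<noteq> 0"
    and W: "superincreasing W n"
    and kept: "\<And>i. i < n \<Longrightarrow> W i \<noteq> 0 \<or> R \<le> card {j. j < n \<and> W j \<noteq> 0 \<and> sum wt (tp j) = sum wt (tp i)}"
    and I: "I \<subseteq> {..<n}" "card I \<le> R" "wins tp n m p I"
  shows "\<exists>x < Suc (\<Sum>j<n. W j). card (greedy W n x) \<le> R \<and> wins tp n m p (greedy W n x)"
proof -
  define I' where "I' = {i \<in> I. p \<notin> tp i}"
  have fin: "finite I" using I finite_subset by blast
  have I': "I' \<subseteq> {..<n}" "finite I'" using I fin by (auto simp: I'_def)
  have cardI': "card I' \<le> R" using card_mono[of I I'] fin I(2) by (auto simp: I'_def)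
  have wins': "wins tp n m p I'" unfolding I'_def using I by (intro wins_drop_supporters)
  have no_p: "{i \<in> I'. p \<in> tp i} = {}" by (auto simp: I'_def)
  have rem_p: "remaining tp n I' p = remaining tp n {} p"
    using remaining_add[OF I'(1), of tp p] no_p by simp
  \<comment> \<open>The score of \<open>p\<close> is unchanged by \<open>I'\<close>, so a candidate
    that was not below it has to lose at least one vote; each deleted vote serves at most
    \<open>r\<close> such candidates.\<close>
  have "rivals - {p} \<subseteq> (\<Union>i\<in>I'. tp i)"
  proof
    fix c assume c: "c \<in> rivals - {p}"
    then have "remaining tp n I' c < remaining tp n I' p"
      using wins' by (auto simp: wins_def rivals)
    then have "card {i \<in> I'. c \<in> tp i} \<noteq> 0"
      using remaining_add[OF I'(1), of tp c] rem_p c by (auto simp: rivals)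
    then have "{i \<in> I'. c \<in> tp i} \<noteq> {}" by (metis card.empty)
    then show "c \<in> (\<Union>i\<in>I'. tp i)" by blast
  qed
  moreover have fin_tp: "finite (tp i)" if "i < n" for i using tp(1)[OF that] finite_subset by blast
  ultimately have "card (rivals - {p}) \<le> card (\<Union>i\<in>I'. tp i)"
    using I' by (intro card_mono) auto
  also have "\<dots> \<le> (\<Sum>i\<in>I'. card (tp i))" by (rule card_UN_le[OF I'(2)])
  also have "\<dots> \<le> (\<Sum>i\<in>I'. r)" using I' tp(2) by (intro sum_mono) auto
  also have "\<dots> \<le> r * R" using cardI' by (simp add: mult.commute)
  finally have "card (rivals - {p}) \<le> r * R" .
  moreover have "p \<in> rivals" "finite rivals" using p by (auto simp: rivals)
  ultimately have "card rivals \<le> r * R + 1" by (simp add: card_Diff_singleton)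
  then have wt_nz: "wt c \<noteq> 0" if "c \<in> rivals" for c using wt(2) that by blast
  define code where "code i = sum wt (tp i)" for i
  \<comment> \<open>A code determines the candidates of nonzero weight among the approved ones, by
    decoding, and every rival has nonzero weight here.\<close>
  have tp_eq: "c \<in> tp i \<longleftrightarrow> c \<in> tp j" if "code i = code j" "i < n" "j < n" "c \<in> rivals" for c i j
  proof -
    define supp where "supp k = {c \<in> tp k. wt c \<noteq> 0}" for k
    have "greedy wt m (code k) = supp k" if "k < n" for k
    proof -
      have "code k = sum wt (supp k)"
        unfolding code_def supp_def using fin_tp[OF that] by (intro sum.mono_neutral_right) auto
      moreover have "supp k \<subseteq> {c. c < m \<and> wt c \<noteq> 0}" using tp(1)[OF that] by (auto simp: supp_def)
      ultimately show ?thesis using greedy_sum[OF wt(1)] by simp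
    qed
    then have "supp i = supp j" using that by metis
    then show ?thesis using wt_nz[OF that(4)] by (auto simp: supp_def)
  qed
  define K where "K = {i. i < n \<and> W i \<noteq> 0}"
  \<comment> \<open>Either all members of the class in \<open>I'\<close> are kept, or some vote of
    the class was dropped; then \<open>R\<close> others are kept, and \<open>I'\<close> has at most
    \<open>R\<close> elements altogether.\<close>
  have "card {i \<in> I'. code i = u} \<le> card {i \<in> K. code i = u}" for u
  proof (cases "{i \<in> I'. code i = u} \<subseteq> K")
    case True
    then show ?thesis by (intro card_mono) (auto simp: K_def)
  next
    case False
    then obtain i where i: "i \<in> I'" "code i = u" "i \<notin> K" by blast
    then have "R \<le> card {j. j < n \<and> W j \<noteq> 0 \<and> code j = u}"
      using kept[of i] I' by (auto simp: K_def code_def)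
    also have "{j. j < n \<and> W j \<noteq> 0 \<and> code j = u} = {i \<in> K. code i = u}" by (auto simp: K_def)
    finally have "R \<le> card {i \<in> K. code i = u}" .
    moreover have "card {i \<in> I'. code i = u} \<le> card I'" using I' by (intro card_mono) auto
    ultimately show ?thesis using cardI' by simp
  qed
  then obtain h where h: "inj_on h I'" "h ` I' \<subseteq> K" "\<And>i. i \<in> I' \<Longrightarrow> code (h i) = code i"
    using card_classes_matching[of I' K code] I' by (auto simp: K_def)
  define J where "J = h ` I'"
  have J: "J \<subseteq> {..<n}" using h(2) by (auto simp: J_def K_def)
  have hits: "card {j \<in> J. c \<in> tp j} = card {i \<in> I'. c \<in> tp i}" if "c \<in> rivals" for c
  proof -
    have "c \<in> tp (h i) \<longleftrightarrow> c \<in> tp i" if "i \<in> I'" for i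
      using tp_eq[of "h i" i c] h(2) h(3)[OF that] that I' \<open>c \<in> rivals\<close> by (auto simp: K_def)
    then have "{j \<in> J. c \<in> tp j} = h ` {i \<in> I'. c \<in> tp i}" by (auto simp: J_def)
    then show ?thesis using h(1) by (simp add: card_image inj_on_def)
  qed
  then have rem_rival: "remaining tp n J c = remaining tp n I' c" if "c \<in> rivals" for c
    using remaining_add[OF J, of tp c] remaining_add[OF I'(1), of tp c] that by simp
  have "wins tp n m p J"
    unfolding wins_def
  proof (intro allI impI)
    fix c assume c: "c < m" "c \<noteq> p"
    show "remaining tp n J c < remaining tp n J p"
    proof (cases "c \<in> rivals")
      case True
      then show ?thesis using wins' c rem_rival \<open>p \<in> rivals\<close> by (simp add: wins_def)
    next
      case False
      \<comment> \<open>A candidate that is not a rival is below \<open>p\<close> from the outset.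
        Exchanging votes may change how many it loses, but it gains none, and the score of
        \<open>p\<close> stays the same because \<open>p\<close> counts as a rival.\<close>
      then have "remaining tp n {} c < remaining tp n {} p" using c by (simp add: rivals)
      then show ?thesis using remaining_add[OF J, of tp c] rem_rival[OF \<open>p \<in> rivals\<close>] rem_p by simp
    qed
  qed
  moreover have "card J \<le> R" using cardI' h(1) by (simp add: J_def card_image)
  moreover have "greedy W n (sum W J) = J"
    using h(2) by (intro greedy_sum[OF W]) (auto simp: J_def K_def)
  moreover have "sum W J \<le> (\<Sum>j<n. W j)" using J by (intro sum_mono2) auto
  \<comment> \<open>The exchanged deletion set \<open>J\<close> consists of kept votes only, so it
    is recovered from its weight, which lies in the search range.\<close>
  ultimately show ?thesis by (intro exI[of _ "sum W J"]) simp
qed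

lemma card_kept_le:
  assumes "\<And>j. j < n \<Longrightarrow> code j < U"
    and "\<And>u. card {j. j < n \<and> W j \<noteq> 0 \<and> code j = u} \<le> R"
  shows "card {j. j < n \<and> W j \<noteq> (0::nat)} \<le> R * (U::nat)"
proof -
  have "{j. j < n \<and> W j \<noteq> 0} = (\<Union>u<U. {j. j < n \<and> W j \<noteq> 0 \<and> code j = u})" using assms(1) by auto
  then have "card {j. j < n \<and> W j \<noteq> 0} \<le> (\<Sum>u<U. card {j. j < n \<and> W j \<noteq> 0 \<and> code j = u})"
    by (simp only:) (rule card_UN_le, simp)
  also have "\<dots> \<le> (\<Sum>u<U. R)" using assms(2) by (intro sum_mono) auto
  finally show ?thesis by (simp add: mult.commute)
qed

section \<open>From multisets of votes to sets of vote indices\<close>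

lemma mset_eq_image_nth: "mset xs = image_mset ((!) xs) (mset_set {..<length xs})"
proof -
  have "mset xs = image_mset ((!) xs) (mset [0..<length xs])"
    unfolding mset_map[symmetric] map_nth ..
  then show ?thesis by (simp add: atLeast0LessThan)
qed

lemma r_DV_iff_wins:
  assumes "p < m" and "tp = (\<lambda>i. set (take r (votes ! i)))"
  shows "r_DV r {0..<m} p (mset votes) R \<longleftrightarrow>
    (\<exists>I. I \<subseteq> {..<length votes} \<and> card I \<le> R \<and> wins tp (length votes) m p I)"
proof -
  let ?n = "length votes"
  let ?sub = "\<lambda>I. image_mset ((!) votes) (mset_set I)"
  have score: "sp_score r (mset votes - ?sub I) c = remaining tp ?n I c" if "I \<subseteq> {..<?n}" for I c
  proof -
    have "mset_set {..<?n} - mset_set I = mset_set ({..<?n} - I)"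
      using that by (simp add: mset_set_Diff)
    moreover have "mset_set I \<subseteq># mset_set {..<?n}"
      using that by (simp add: subset_imp_msubset_mset_set)
    ultimately have "mset votes - ?sub I = ?sub ({..<?n} - I)"
      by (simp add: mset_eq_image_nth[of votes] image_mset_Diff[symmetric])
    moreover have "{x \<in> {..<?n} - I. c \<in> tp x} = {i. i < ?n \<and> i \<notin> I \<and> c \<in> tp i}" by auto
    ultimately show ?thesis
      by (simp add: sp_score_def remaining_def filter_mset_image_mset assms(2))
  qed
  have "unique_winner r {0..<m} (mset votes - ?sub I) p \<longleftrightarrow> wins tp ?n m p I" if "I \<subseteq> {..<?n}" for I
    using that assms(1) by (auto simp: unique_winner_def wins_def score)
  moreover have "\<exists>I \<subseteq> {..<?n}. T = ?sub I" if T: "T \<subseteq># mset votes" for T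
  proof -
    obtain U where "mset votes = T + U" using T by (auto simp: mset_subset_eq_exists_conv)
    \<comment> \<open>Splitting \<open>mset votes\<close> into \<open>T\<close> and \<open>U\<close>
      lifts to a splitting of the index multiset. There every multiplicity is at most 1, so
      \<open>A\<close> is in fact a set; this is how equal votes are told apart.\<close>
    then obtain A B where AB: "mset_set {..<?n} = A + B" "T = image_mset ((!) votes) A"
      unfolding mset_eq_image_nth[of votes] by (auto dest: image_mset_eq_plusD)
    have "count A x \<le> (if x < ?n then 1 else 0)" for x
      using arg_cong[OF AB(1), of "\<lambda>M. count M x"] by (simp add: count_mset_set' split: if_splits)
    then have *: "count A x = (if x \<in># A then 1 else 0)" "x \<in># A \<Longrightarrow> x < ?n" for x
      by (metis count_eq_zero_iff le_antisym less_one linorder_not_less le_zero_eq)+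
    have "A = mset_set (set_mset A)"
      by (rule multiset_eqI) (simp add: *(1) count_mset_set')
    then show ?thesis using AB(2) *(2) by (intro exI[of _ "set_mset A"]) auto
  qed
  moreover have "?sub I \<subseteq># mset votes" "size (?sub I) = card I" if "I \<subseteq> {..<?n}" for I
    using that by (simp_all add: mset_eq_image_nth[of votes] image_mset_subseteq_mono subset_imp_msubset_mset_set)
  ultimately show ?thesis unfolding r_DV_def by metis
qed

section \<open>The algorithm\<close>

abbreviation (input) "vOut \<equiv> 0 :: nat"
abbreviation (input) "vM \<equiv> 2 :: nat"
abbreviation (input) "vP \<equiv> 3 :: nat"
abbreviation (input) "vQ \<equiv> 4 :: nat"
abbreviation (input) "vR \<equiv> 5 :: nat"
abbreviation (input) "vN \<equiv> 6 :: nat"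
abbreviation (input) "vTop \<equiv> 7 :: nat"
abbreviation (input) "vEnd \<equiv> 8 :: nat"
abbreviation (input) "vB \<equiv> 9 :: nat"
abbreviation (input) "vD \<equiv> 10 :: nat"
abbreviation (input) "vY \<equiv> 11 :: nat"
abbreviation (input) "vX \<equiv> 12 :: nat"
abbreviation (input) "vI \<equiv> 13 :: nat"
abbreviation (input) "vA \<equiv> 14 :: nat"
abbreviation (input) "vC \<equiv> 15 :: nat"
abbreviation (input) "vT \<equiv> 16 :: nat"
abbreviation (input) "vU \<equiv> 17 :: nat"
abbreviation (input) "vW \<equiv> 18 :: nat"
abbreviation (input) "vF \<equiv> 19 :: nat"
abbreviation (input) "vSP \<equiv> 20 :: nat"
abbreviation (input) "vPow \<equiv> 21 :: nat"
abbreviation (input) "vCap \<equiv> 22 :: nat"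
abbreviation (input) "vCode \<equiv> 23 :: nat"
abbreviation (input) "vNum \<equiv> 24 :: nat"
abbreviation (input) "vZ \<equiv> 25 :: nat"
abbreviation (input) "vOk \<equiv> 26 :: nat"
abbreviation (input) "vZero \<equiv> 27 :: nat"
abbreviation (input) "vOne \<equiv> 29 :: nat"
abbreviation (input) "aIn \<equiv> 0 :: nat"
abbreviation (input) "aS \<equiv> 2 :: nat"
abbreviation (input) "aWt \<equiv> 3 :: nat"
abbreviation (input) "aCnt \<equiv> 4 :: nat"
abbreviation (input) "aW \<equiv> 5 :: nat"

text \<open>On entry \<open>vQ\<close>, which is cell 4, holds the index of the last header entry,
  so the header is read backwards as \<open>n\<close>, \<open>R\<close>, \<open>p\<close>,
  \<open>m\<close>. With truncated subtraction, \<open>r - (r - m)\<close> is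
  \<open>min r m\<close>.\<close>

definition header_com :: "nat \<Rightarrow> com" where
  "header_com r =
     Const vOne 1 ;; Const vZero 0 ;; Const vOut 0 ;;
     Get vN aIn vQ ;; Sub vQ vQ vOne ;; Get vR aIn vQ ;; Sub vQ vQ vOne ;;
     Get vP aIn vQ ;; Sub vQ vQ vOne ;; Get vM aIn vQ ;;
     Const vT r ;; Sub vU vT vM ;; Sub vTop vT vU"

definition end_com :: com where
  "end_com = Const vEnd 5 ;; Loop vI vN (Add vEnd vEnd vM)"

definition clear_com :: com where
  "clear_com = Const vC 0 ;; Loop vI vM (Put aS vC vZero ;; Add vC vC vOne)"

definition add_vote_com :: com where
  "add_vote_com = Add vQ vB vZero ;;
     Loop vA vTop (Get vC aIn vQ ;; Get vT aS vC ;; Add vT vT vF ;; Put aS vC vT ;; Add vQ vQ vOne)"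

text \<open>The weight of vote \<open>i\<close> is stored at index \<open>Suc i\<close> of the array \<open>aW\<close>.\<close>

definition decide_com :: com where
  "decide_com = Sub vB vB vM ;; Get vW aW vI ;; Const vF 1 ;;
     Cond vW
       (Add vT vY vOne ;; Sub vT vT vW ;;
        Cond vT (Sub vY vY vW ;; Add vD vD vOne ;; Const vF 0) Skip)
       Skip"

text \<open>Votes are visited from the last to the first because \<open>greedy\<close> tries large
  indices first. \<open>vF\<close> becomes 0 for a deleted vote and 1 otherwise, and is what the
  vote contributes to each approved candidate. Comparisons \<open>a \<le> b\<close> are made
  throughout by testing \<open>b + 1 - a\<close> for being nonzero.\<close>

definition score_com :: com where
  "score_com = clear_com ;; Add vB vEnd vZero ;; Const vD 0 ;;
     Loop vI vN (decide_com ;; add_vote_com)"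

definition cap_com :: "nat \<Rightarrow> com" where
  "cap_com r = Const vT r ;; Const vCap 1 ;; Loop vI vR (Add vCap vCap vT)"

text \<open>Once \<open>vCap\<close> is used up, further rivals keep weight 0. This keeps all codes
  below \<open>2 ^ (r * R + 1)\<close> and loses information only on unsolvable instances.\<close>

definition rivals_com :: com where
  "rivals_com = Get vSP aS vP ;; Const vC 0 ;; Const vPow 1 ;;
     Loop vI vM
       (Get vT aS vC ;; Add vT vT vOne ;; Sub vT vT vSP ;;
        Cond vT
          (Cond vCap (Put aWt vC vPow ;; Add vPow vPow vPow ;; Sub vCap vCap vOne) Skip)
          Skip ;;
        Add vC vC vOne)"

definition code_com :: com where
  "code_com = Const vCode 0 ;; Add vQ vB vZero ;;
     Loop vA vTop (Get vC aIn vQ ;; Get vT aWt vC ;; Add vCode vCode vT ;; Add vQ vQ vOne)"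

text \<open>\<open>vNum\<close> is both the next free weight and, at the end, the number of deletion
  codes. \<open>vU\<close> runs one ahead of the vote index, as the layout of \<open>aW\<close>
  requires.\<close>

definition keep_com :: com where
  "keep_com = Const vNum 1 ;; Const vU 0 ;; Const vB 5 ;;
     Loop vI vN
       (Add vU vU vOne ;; code_com ;;
        (Get vT aCnt vCode ;; Sub vW vR vT ;;
         Cond vW
           (Add vT vT vOne ;; Put aCnt vCode vT ;; Put aW vU vNum ;; Add vNum vNum vNum)
           Skip ;;
         Add vB vB vM))"

text \<open>The sum of the two truncated differences of \<open>vC\<close> and \<open>vP\<close> is
  nonzero exactly when the candidate is not \<open>p\<close>.\<close>

definition check_com :: com where
  "check_com = Const vOk 1 ;; Sub vT vD vR ;; Cond vT (Const vOk 0) Skip ;;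
     Get vSP aS vP ;; Const vC 0 ;;
     Loop vI vM
       (Sub vT vC vP ;; Sub vU vP vC ;; Add vT vT vU ;;
        Cond vT
          (Get vT aS vC ;; Add vT vT vOne ;; Sub vT vT vSP ;; Cond vT (Const vOk 0) Skip)
          Skip ;;
        Add vC vC vOne)"

definition try_com :: com where
  "try_com = Add vY vX vZero ;; score_com ;; check_com ;;
     Cond vOk (Const vOut 1) Skip ;; Add vX vX vOne"

definition search_com :: com where
  "search_com = Const vX 0 ;; Loop vZ vNum try_com"

definition kernel_com :: "nat \<Rightarrow> com" where
  "kernel_com r = end_com ;; Const vY 0 ;; score_com ;; cap_com r ;; rivals_com ;; keep_com"

text \<open>Without votes \<open>m\<close> is not bounded by the length of the input, so this case must not
loop over the candidates.\<close>

definition main_com :: "nat \<Rightarrow> com" where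
  "main_com r = header_com r ;;
     Cond vN (kernel_com r ;; search_com) (Sub vT vM vOne ;; Cond vT Skip (Const vOut 1))"

lemma wvars_coms [simp]:
  "wvars end_com = {vEnd, vI}"
  "wvars clear_com = {vC, vI}"
  "wvars add_vote_com = {vQ, vA, vC, vT}"
  "wvars decide_com = {vB, vW, vF, vT, vY, vD}"
  "wvars score_com = {vB, vW, vF, vT, vY, vD, vQ, vA, vC, vI}"
  "wvars (cap_com r) = {vT, vCap, vI}"
  "wvars rivals_com = {vSP, vC, vPow, vI, vT, vCap}"
  "wvars code_com = {vCode, vQ, vA, vC, vT}"
  "wvars keep_com = {vNum, vU, vB, vI, vCode, vQ, vA, vC, vT, vW}"
  "wvars check_com = {vOk, vT, vSP, vC, vI, vU}"
  "wvars try_com = {vY, vB, vW, vF, vT, vD, vQ, vA, vC, vI, vOk, vSP, vU, vOut, vX}"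
  by (auto simp: end_com_def clear_com_def add_vote_com_def decide_com_def score_com_def
    cap_com_def rivals_com_def code_com_def keep_com_def check_com_def try_com_def)

lemma warrs_coms [simp]:
  "warrs end_com = {}"
  "warrs clear_com = {aS}"
  "warrs add_vote_com = {aS}"
  "warrs decide_com = {}"
  "warrs score_com = {aS}"
  "warrs (cap_com r) = {}"
  "warrs rivals_com = {aWt}"
  "warrs code_com = {}"
  "warrs keep_com = {aCnt, aW}"
  "warrs check_com = {}"
  "warrs try_com = {aS}"
  by (auto simp: end_com_def clear_com_def add_vote_com_def decide_com_def score_com_def
    cap_com_def rivals_com_def code_com_def keep_com_def check_com_def try_com_def)

lemmas com_defs = end_com_def clear_com_def add_vote_com_def decide_com_def score_com_def
  cap_com_def rivals_com_def code_com_def keep_com_def check_com_def try_com_def search_com_def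
  kernel_com_def

lemma bvars_coms [simp]:
  "bvars (kernel_com r) = {vN, vM, vTop, vR}"
  "bvars try_com = {vN, vM, vTop}"
  "bvars search_com = {vNum, vN, vM, vTop}"
  by (auto simp: com_defs)

lemma wvars_kernel_search [simp]:
  "wvars (kernel_com r) = {vEnd, vI, vY, vB, vW, vF, vT, vD, vQ, vA, vC, vCap, vSP, vPow, vNum, vU, vCode}"
  "wvars search_com = {vX, vZ, vY, vB, vW, vF, vT, vD, vQ, vA, vC, vI, vOk, vSP, vU, vOut}"
  by (auto simp: kernel_com_def search_com_def)

lemma wf_main: "wf_com (main_com r)"
  by (simp add: main_com_def header_com_def com_defs)

text \<open>Loops are nested to depth two, so the cost is quadratic. The factor 1000 is a generous
  round number; only its being constant matters.\<close>

lemma cost_bound_kernel: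
  assumes "1 \<le> L"
  shows "cost_bound (kernel_com r) (\<lambda>_. L) \<le> 1000 * L ^ 2"
proof -
  have "L \<le> L * L" "1 \<le> L * L" using assms by auto
  moreover have "cost_bound (kernel_com r) (\<lambda>_. L) = 38 + 119 * L + 52 * (L * L)"
    by (simp add: com_defs algebra_simps)
  ultimately show ?thesis unfolding power2_eq_square by linarith
qed

lemma cost_bound_try:
  assumes "1 \<le> L"
  shows "4 + cost_bound try_com (\<lambda>_. L) \<le> 1000 * L ^ 2"
proof -
  have "L \<le> L * L" "1 \<le> L * L" using assms by auto
  moreover have "4 + cost_bound try_com (\<lambda>_. L) = 35 + 63 * L + 30 * (L * L)"
    by (simp add: com_defs algebra_simps)
  ultimately show ?thesis unfolding power2_eq_square by linarith
qed

text \<open>From here on loops are treated only through \<open>Loop_invariant\<close> and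
  \<open>cost_bound\<close>, so simplification must stop at them.\<close>

declare exec.simps(9) [simp del] cost.simps(9) [simp del]

section \<open>Correctness of the program fragments on a fixed instance\<close>

locale instance_data =
  fixes r m p R :: nat and votes :: "nat list list"
  assumes valid: "valid_instance m p votes R"
begin

abbreviation n :: nat where "n \<equiv> length votes"

definition tp :: "nat \<Rightarrow> nat set" where
  "tp i = set (take r (votes ! i))"

lemma p_less: "p < m" and R_le: "R \<le> n"
  using valid by (auto simp: valid_instance_def)

lemma vote:
  assumes "i < n"
  shows "distinct (votes ! i)" "set (votes ! i) = {0..<m}" "length (votes ! i) = m"
proof -
  show d: "distinct (votes ! i)" and s: "set (votes ! i) = {0..<m}"
    using valid assms by (auto simp: valid_instance_def is_vote_def)
  show "length (votes ! i) = m" using distinct_card[OF d] by (simp add: s)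
qed

lemma tp_eq: "i < n \<Longrightarrow> tp i = set (take (min r m) (votes ! i))"
  by (cases "r \<le> m") (auto simp: tp_def min_def vote)

lemma tp_subset: "i < n \<Longrightarrow> tp i \<subseteq> {..<m}"
  using vote(2)[of i] set_take_subset[of r "votes ! i"] by (auto simp: tp_def)

lemma card_tp: "card (tp i) \<le> r"
  unfolding tp_def by (rule order_trans[OF card_length]) simp

text \<open>What the fragments after \<open>end_com\<close> read but never write. The votes start at
  index 5, since cell 0 held the length of the input and cells 1 to 4 the header.\<close>

definition base :: "state \<Rightarrow> bool" where
  "base s \<longleftrightarrow> fst s vOne = 1 \<and> fst s vZero = 0 \<and> fst s vM = m \<and> fst s vP = p \<and> fst s vR = R \<and>
     fst s vN = n \<and> fst s vTop = min r m \<and> fst s vEnd = 5 + n * m \<and>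
     (\<forall>i<n. \<forall>a<m. snd s aIn (5 + i * m + a) = votes ! i ! a)"

lemma base_simps:
  assumes "base s"
  shows "fst s vOne = 1" "fst s vZero = 0" "fst s vM = m" "fst s vP = p" "fst s vR = R"
    "fst s vN = n" "fst s vTop = min r m" "fst s vEnd = 5 + n * m"
  using assms by (auto simp: base_def)

lemma base_cong:
  assumes "base s" "\<And>v. v \<in> {vOne, vZero, vM, vP, vR, vN, vTop, vEnd} \<Longrightarrow> fst s' v = fst s v"
    "snd s' aIn = snd s aIn"
  shows "base s'"
  using assms by (simp add: base_def)

lemma base_exec:
  assumes "base s" "wvars c \<inter> {vOne, vZero, vM, vP, vR, vN, vTop, vEnd} = {}" "aIn \<notin> warrs c"
  shows "base (exec c s)"
  using assms(2,3) by (intro base_cong[OF assms(1)] frame_var frame_arr) auto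

lemma exec_clear:
  assumes "base s" "c < m"
  shows "snd (exec clear_com s) aS c = 0"
proof -
  let ?P = "\<lambda>i u. fst u vC = i \<and> (\<forall>c<i. snd u aS c = 0)"
  have "?P m (exec (Loop vI vM (Put aS vC vZero ;; Add vC vC vOne)) (setv vC 0 s))"
    by (rule Loop_invariant[where P = ?P]) (use assms(1) in \<open>auto simp: base_simps less_Suc_eq\<close>)
  then show ?thesis using assms(2) by (simp add: clear_com_def)
qed

lemma exec_add_vote:
  assumes "base s" "i < n" "fst s vB = 5 + i * m"
  shows "snd (exec add_vote_com s) aS c = snd s aS c + (if c \<in> tp i then fst s vF else 0)"
proof -
  let ?v = "votes ! i"
  let ?s = "setv vQ (5 + i * m) s"
  let ?body = "Get vC aIn vQ ;; Get vT aS vC ;; Add vT vT vF ;; Put aS vC vT ;; Add vQ vQ vOne"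
  let ?P = "\<lambda>k u. fst u vQ = 5 + i * m + k \<and>
     (\<forall>c. snd u aS c = snd s aS c + (if c \<in> set (take k ?v) then fst s vF else 0))"
  have "?P (min r m) (exec (Loop vA vTop ?body) ?s)"
  proof (rule Loop_invariant[where P = ?P])
    fix k u
    assume k: "k < min r m" and P: "?P k u"
      and fv: "\<And>v. v \<notin> insert vA (wvars ?body) \<Longrightarrow> fst u v = fst ?s v"
      and fa: "\<And>j. j \<notin> warrs ?body \<Longrightarrow> snd u j = snd ?s j"
    have "snd u aIn (5 + i * m + k) = ?v ! k"
      using k assms(1,2) fa[of aIn] by (simp add: base_def)
    moreover have "fst u vF = fst s vF" "fst u vOne = 1"
      using fv[of vF] fv[of vOne] assms(1) by (auto simp: base_simps)
    moreover have "k < length ?v" using k vote(3)[OF assms(2)] by simp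
    moreover have "?v ! k \<notin> set (take k ?v)"
      using vote(1)[OF assms(2)] \<open>k < length ?v\<close> by (rule nth_notin_set_take)
    ultimately show "?P (Suc k) (setv vA (min r m - Suc k) (exec ?body u))"
      using P by (auto simp: set_take_Suc)
  qed (use assms(1) in \<open>auto simp: base_simps\<close>)
  moreover have "exec add_vote_com s = exec (Loop vA vTop ?body) ?s"
    using assms by (simp add: add_vote_com_def base_simps)
  ultimately show ?thesis using tp_eq[OF assms(2)] by simp
qed

text \<open>The shift matches the descending counter of \<open>score_com\<close>, which equals
  \<open>Suc k\<close> while vote \<open>k\<close> is treated.\<close>

definition weight :: "state \<Rightarrow> nat \<Rightarrow> nat" where
  "weight s i = snd s aW (Suc i)"

lemma weight_setv [simp]: "weight (setv v x s) = weight s"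
  by (simp add: weight_def fun_eq_iff)

text \<open>The invariant says that what has been done plus what is still to come is the final
  result. The part to come is \<open>greedy\<close> on the votes not yet visited, applied to what is
  left of the code in \<open>vY\<close>; it vanishes at the end.\<close>

lemma exec_score:
  assumes "base s"
  defines "G \<equiv> greedy (weight s) n (fst s vY)"
  shows "fst (exec score_com s) vD = card G"
    and "\<And>c. c < m \<Longrightarrow> snd (exec score_com s) aS c = remaining tp n G c"
proof -
  define s0 where "s0 = exec (clear_com ;; Add vB vEnd vZero ;; Const vD 0) s"
  let ?body = "decide_com ;; add_vote_com"
  let ?G = "\<lambda>k u. greedy (weight s) k (fst u vY)"
  let ?P = "\<lambda>i u. fst u vB = 5 + (n - i) * m \<and> fst u vD + card (?G (n - i) u) = card G \<and>
     (\<forall>c<m. snd u aS c + remaining tp (n - i) (?G (n - i) u) c = remaining tp n G c)"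
  have base0: "base s0" unfolding s0_def
    using assms(1) by (intro base_exec) simp_all
  have Y0: "fst s0 vY = fst s vY" and W0: "snd s0 aW = snd s aW"
    unfolding s0_def by (simp_all add: frame_var frame_arr)
  have "?P n (exec (Loop vI vN ?body) s0)"
  proof (rule Loop_invariant[where P = ?P])
    show "fst s0 vN = n" using base0 by (simp add: base_simps)
    have "base (exec clear_com s)"
      using assms(1) by (intro base_exec) simp_all
    then show "?P 0 (setv vI n s0)"
      using exec_clear[OF assms(1)] Y0 by (simp add: G_def s0_def base_simps)
  next
    fix i u
    assume i: "i < n" and P: "?P i u" and I: "fst u vI = n - i"
      and fv: "\<And>v. v \<notin> insert vI (wvars ?body) \<Longrightarrow> fst u v = fst s0 v"
      and fa: "\<And>j. j \<notin> warrs ?body \<Longrightarrow> snd u j = snd s0 j"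
    define k where "k = n - Suc i"
    have k: "n - i = Suc k" "n - Suc i = k" "k < n" using i by (auto simp: k_def)
    have bu: "base u"
      by (rule base_cong[OF base0]) (use fv fa in auto)
    have W: "snd u aW (Suc k) = weight s k"
      using fa[of aW] W0 by (simp add: weight_def)
    let ?u = "exec decide_com u"
    have bu': "base ?u" using bu by (intro base_exec) simp_all
    have B: "fst ?u vB = 5 + k * m" and S: "snd ?u aS = snd u aS"
      using P by (simp_all add: decide_com_def k base_simps[OF bu])
    have "fst ?u vD + card (?G k ?u) = card G \<and> (\<forall>c<m. snd u aS c +
         (if c \<in> tp k then fst ?u vF else 0) + remaining tp k (?G k ?u) c = remaining tp n G c)"
    proof (cases "weight s k \<noteq> 0 \<and> weight s k \<le> fst u vY")
      case True
      then have "fst ?u vD = Suc (fst u vD)" "fst ?u vF = 0" "fst ?u vY = fst u vY - weight s k"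
        by (simp_all add: decide_com_def I k W base_simps[OF bu])
      then show ?thesis using P True by (simp add: k remaining_Suc_insert)
    next
      case False
      then have "fst ?u vD = fst u vD" "fst ?u vF = 1" "fst ?u vY = fst u vY"
        by (auto simp: decide_com_def I k W base_simps[OF bu])
      moreover have "?G (Suc k) u = ?G k u" using False by auto
      ultimately show ?thesis using P by (auto simp: k remaining_Suc simp del: greedy.simps)
    qed
    then show "?P (Suc i) (setv vI (n - Suc i) (exec ?body u))"
      using exec_add_vote[OF bu' k(3) B] B
      by (simp add: k S frame_var)
  qed simp
  moreover have "exec score_com s = exec (Loop vI vN ?body) s0"
    by (simp add: score_com_def s0_def)
  moreover have "remaining tp 0 X c = 0" for X c by (simp add: remaining_def)
  ultimately show "fst (exec score_com s) vD = card G"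
    and "\<And>c. c < m \<Longrightarrow> snd (exec score_com s) aS c = remaining tp n G c"
    by simp_all
qed

definition rivals :: "nat set" where
  "rivals = {c. c < m \<and> remaining tp n {} p \<le> remaining tp n {} c}"

lemma exec_cap:
  assumes "base s"
  shows "fst (exec (cap_com r) s) vCap = r * R + 1"
proof -
  let ?P = "\<lambda>i u. fst u vCap = r * i + 1"
  have "?P R (exec (Loop vI vR (Add vCap vCap vT)) (setv vCap 1 (setv vT r s)))"
    by (rule Loop_invariant[where P = ?P]) (use assms in \<open>auto simp: base_simps\<close>)
  then show ?thesis by (simp add: cap_com_def)
qed

text \<open>Each assigned weight doubles \<open>vPow\<close> and lowers \<open>vCap\<close> by 1, so
  \<open>vPow * 2 ^ vCap\<close> is constant and bounds the total weight. The lower bound on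
  \<open>vCap\<close> plus the number of rivals seen is an inequality because rivals are still
  counted after the cap is exhausted.\<close>

lemma exec_rivals:
  assumes "base s" and S: "\<And>c. c < m \<Longrightarrow> snd s aS c = remaining tp n {} c"
    and Wt: "snd s aWt = (\<lambda>_. 0)" and Cap: "fst s vCap = r * R + 1"
  defines "wt \<equiv> snd (exec rivals_com s) aWt"
  shows "superincreasing wt m" "Suc (\<Sum>c<m. wt c) \<le> 2 ^ (r * R + 1)"
    "card rivals \<le> r * R + 1 \<Longrightarrow> \<forall>c\<in>rivals. wt c \<noteq> 0"
proof -
  let ?body = "Get vT aS vC ;; Add vT vT vOne ;; Sub vT vT vSP ;;
        Cond vT
          (Cond vCap (Put aWt vC vPow ;; Add vPow vPow vPow ;; Sub vCap vCap vOne) Skip)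
          Skip ;;
        Add vC vC vOne"
  define s0 where "s0 = setv vPow 1 (setv vC 0 (setv vSP (remaining tp n {} p) s))"
  let ?P = "\<lambda>i u. fst u vC = i \<and> (\<forall>c\<ge>i. snd u aWt c = 0) \<and> superincreasing (snd u aWt) i \<and>
     fst u vPow = Suc (\<Sum>c<i. snd u aWt c) \<and> fst u vPow * 2 ^ fst u vCap = 2 ^ (r * R + 1) \<and>
     r * R + 1 \<le> fst u vCap + card {c \<in> rivals. c < i} \<and>
     (card rivals \<le> r * R + 1 \<longrightarrow> (\<forall>c\<in>rivals. c < i \<longrightarrow> snd u aWt c \<noteq> 0))"
  have finr: "finite rivals" by (simp add: rivals_def)
  have loop: "?P m (exec (Loop vI vM ?body) s0)"
  proof (rule Loop_invariant[where P = ?P])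
    show "fst s0 vM = m" using assms(1) by (simp add: s0_def base_simps)
    show "?P 0 (setv vI m s0)" using Wt Cap by (simp add: s0_def superincreasing_def)
  next
    fix i u
    assume i: "i < m" and P: "?P i u"
      and fv: "\<And>v. v \<notin> insert vI (wvars ?body) \<Longrightarrow> fst u v = fst s0 v"
      and fa: "\<And>j. j \<notin> warrs ?body \<Longrightarrow> snd u j = snd s0 j"
    have one: "fst u vOne = Suc 0" using fv[of vOne] assms(1) by (simp add: s0_def base_simps)
    have SP: "fst u vSP = remaining tp n {} p" using fv[of vSP] by (simp add: s0_def)
    have S': "snd u aS i = remaining tp n {} i" using fa[of aS] S[OF i] by (simp add: s0_def)
    have C: "fst u vC = i" using P by simp
    show "?P (Suc i) (setv vI (m - Suc i) (exec ?body u))"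
    proof (cases "i \<in> rivals")
      case False
      then have "exec ?body u = setv vC (Suc i) (setv vT 0 u)"
        using i by (simp add: C S' one SP rivals_def setv_def Suc_diff_le not_le)
      moreover have "{c \<in> rivals. c < Suc i} = {c \<in> rivals. c < i}"
        using False by (auto simp: less_Suc_eq)
      ultimately show ?thesis using P False by (auto simp: superincreasing_Suc less_Suc_eq)
    next
      case True
      then have le: "remaining tp n {} p \<le> remaining tp n {} i" by (simp add: rivals_def)
      have "{c \<in> rivals. c < Suc i} = insert i {c \<in> rivals. c < i}"
        using True by (auto simp: less_Suc_eq)
      then have card: "card {c \<in> rivals. c < Suc i} = Suc (card {c \<in> rivals. c < i})"
        using finr by simp
      let ?t = "Suc (remaining tp n {} i) - remaining tp n {} p"
      show ?thesis
      proof (cases "fst u vCap")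
        case 0
        then have "exec ?body u = setv vC (Suc i) (setv vT ?t u)"
          using le by (simp add: C S' one SP setv_def fun_upd_twist)
        \<comment> \<open>With the cap exhausted this rival is one too many, so the claim that all
          rivals have nonzero weight becomes vacuous.\<close>
        moreover have "r * R + 1 < card {c \<in> rivals. c < Suc i}" using P card 0 by simp
        moreover have "card {c \<in> rivals. c < Suc i} \<le> card rivals" using finr by (intro card_mono) auto
        ultimately show ?thesis using P by (auto simp: superincreasing_Suc)
      next
        case (Suc k)
        define v where "v = exec ?body u"
        have v: "fst v vC = Suc i" "fst v vPow = 2 * fst u vPow" "fst v vCap = k"
          "snd v aWt = (snd u aWt)(i := fst u vPow)"
          unfolding v_def using le Suc by (simp_all add: C S' one SP)
        have sums: "(\<Sum>c<i. snd v aWt c) = (\<Sum>c<i. snd u aWt c)" by (intro sum.cong) (auto simp: v)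
        have "superincreasing (snd v aWt) i"
          using P by (subst superincreasing_cong[of i _ "snd u aWt"]) (auto simp: v)
        moreover have "snd v aWt i = Suc (\<Sum>c<i. snd v aWt c)" using P by (simp add: v sums[unfolded v])
        moreover have "fst v vPow = Suc (\<Sum>c<Suc i. snd v aWt c)"
          using P by (simp add: sums) (simp add: v)
        moreover have "fst u vPow * 2 ^ fst u vCap = 2 ^ (r * R + 1)" using P by blast
        then have "fst v vPow * 2 ^ fst v vCap = 2 ^ (r * R + 1)" using Suc by (simp add: v)
        moreover have "r * R + 1 \<le> fst v vCap + card {c \<in> rivals. c < Suc i}"
          using P Suc by (simp add: v card)
        moreover have "card rivals \<le> r * R + 1 \<longrightarrow> (\<forall>c\<in>rivals. c < Suc i \<longrightarrow> snd v aWt c \<noteq> 0)"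
          using P by (auto simp: v less_Suc_eq)
        moreover have "\<forall>c\<ge>Suc i. snd v aWt c = 0" using P by (simp add: v)
        moreover have "fst v vC = Suc i" by (simp add: v)
        ultimately show ?thesis
          unfolding v_def[symmetric] superincreasing_Suc by simp
      qed
    qed
  qed simp
  have eq: "exec rivals_com s = exec (Loop vI vM ?body) s0"
    using S[OF p_less] assms(1) by (simp add: rivals_com_def s0_def base_simps)
  have P: "?P m (exec rivals_com s)" unfolding eq by (rule loop)
  then show "superincreasing wt m" by (simp add: wt_def)
  show "\<forall>c\<in>rivals. wt c \<noteq> 0" if "card rivals \<le> r * R + 1"
    using P that by (auto simp: wt_def rivals_def)
  have "Suc (\<Sum>c<m. wt c) * 1 \<le> Suc (\<Sum>c<m. wt c) * 2 ^ fst (exec rivals_com s) vCap"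
    by (intro mult_le_mono2) simp
  also have "\<dots> = 2 ^ (r * R + 1)"
  proof -
    have "fst (exec rivals_com s) vPow = Suc (\<Sum>c<m. wt c)"
      "fst (exec rivals_com s) vPow * 2 ^ fst (exec rivals_com s) vCap = 2 ^ (r * R + 1)"
      using P unfolding wt_def by blast+
    then show ?thesis by (simp only:)
  qed
  finally show "Suc (\<Sum>c<m. wt c) \<le> 2 ^ (r * R + 1)" by simp
qed

definition code :: "(nat \<Rightarrow> nat) \<Rightarrow> nat \<Rightarrow> nat" where
  "code wt i = sum wt (tp i)"

lemma exec_code:
  assumes "base s" "i < n" "fst s vB = 5 + i * m"
  shows "fst (exec code_com s) vCode = code (snd s aWt) i"
proof -
  let ?v = "votes ! i"
  let ?s = "setv vQ (5 + i * m) (setv vCode 0 s)"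
  let ?body = "Get vC aIn vQ ;; Get vT aWt vC ;; Add vCode vCode vT ;; Add vQ vQ vOne"
  let ?P = "\<lambda>k u. fst u vQ = 5 + i * m + k \<and> fst u vCode = sum (snd s aWt) (set (take k ?v))"
  have "?P (min r m) (exec (Loop vA vTop ?body) ?s)"
  proof (rule Loop_invariant[where P = ?P])
    fix k u
    assume k: "k < min r m" and P: "?P k u"
      and fv: "\<And>v. v \<notin> insert vA (wvars ?body) \<Longrightarrow> fst u v = fst ?s v"
      and fa: "\<And>j. j \<notin> warrs ?body \<Longrightarrow> snd u j = snd ?s j"
    have "snd u aIn (5 + i * m + k) = ?v ! k" "snd u aWt = snd s aWt"
      using k assms(1,2) fa[of aIn] fa[of aWt] by (simp_all add: base_def)
    moreover have "fst u vOne = 1"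
      using fv[of vOne] assms(1) by (simp add: base_simps)
    moreover have "k < length ?v" using k vote(3)[OF assms(2)] by simp
    moreover have "?v ! k \<notin> set (take k ?v)"
      using vote(1)[OF assms(2)] \<open>k < length ?v\<close> by (rule nth_notin_set_take)
    ultimately show "?P (Suc k) (setv vA (min r m - Suc k) (exec ?body u))"
      using P by (auto simp: set_take_Suc)
  qed (use assms(1) in \<open>auto simp: base_simps\<close>)
  moreover have "exec code_com s = exec (Loop vA vTop ?body) ?s"
    using assms by (simp add: code_com_def base_simps)
  ultimately show ?thesis using tp_eq[OF assms(2)] by (simp add: code_def)
qed

text \<open>A vote is dropped only when the counter of its class has reached \<open>R\<close>, and
  counters never decrease; so every dropped vote has \<open>R\<close> kept ones of its
  class.\<close>

lemma exec_keep:
  assumes "base s" and W0: "snd s aW = (\<lambda>_. 0)" and Cnt0: "snd s aCnt = (\<lambda>_. 0)"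
  defines "W \<equiv> weight (exec keep_com s)" and "cd \<equiv> code (snd s aWt)"
  shows "superincreasing W n" "fst (exec keep_com s) vNum = Suc (\<Sum>j<n. W j)"
    "\<And>i. i < n \<Longrightarrow> W i \<noteq> 0 \<or> R \<le> card {j. j < n \<and> W j \<noteq> 0 \<and> cd j = cd i}"
    "\<And>u. card {j. j < n \<and> W j \<noteq> 0 \<and> cd j = u} \<le> R"
proof -
  let ?tail = "Get vT aCnt vCode ;; Sub vW vR vT ;;
         Cond vW
           (Add vT vT vOne ;; Put aCnt vCode vT ;; Put aW vU vNum ;; Add vNum vNum vNum)
           Skip ;;
         Add vB vB vM"
  let ?body = "Add vU vU vOne ;; code_com ;; ?tail"
  define s0 where "s0 = setv vB 5 (setv vU 0 (setv vNum 1 s))"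
  define cls where "cls w i u = {j. j < i \<and> w j \<noteq> 0 \<and> cd j = u}" for w :: "nat \<Rightarrow> nat" and i u
  let ?P = "\<lambda>i u. fst u vU = i \<and> fst u vB = 5 + i * m \<and> superincreasing (weight u) i \<and>
     fst u vNum = Suc (\<Sum>j<i. weight u j) \<and> (\<forall>j\<ge>i. weight u j = 0) \<and>
     (\<forall>x. snd u aCnt x = card (cls (weight u) i x)) \<and> (\<forall>x. snd u aCnt x \<le> R) \<and>
     (\<forall>j<i. weight u j \<noteq> 0 \<or> R \<le> snd u aCnt (cd j))"
  have fin: "finite (cls w i u)" for w i u by (simp add: cls_def)
  have loop: "?P n (exec (Loop vI vN ?body) s0)"
  proof (rule Loop_invariant[where P = ?P])
    show "fst s0 vN = n" using assms(1) by (simp add: s0_def base_simps)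
    show "?P 0 (setv vI n s0)" using W0 Cnt0
      by (simp add: s0_def superincreasing_def weight_def cls_def)
  next
    fix i u
    assume i: "i < n" and P: "?P i u"
      and fv: "\<And>v. v \<notin> insert vI (wvars ?body) \<Longrightarrow> fst u v = fst s0 v"
      and fa: "\<And>j. j \<notin> warrs ?body \<Longrightarrow> snd u j = snd s0 j"
    have bu: "base u"
      by (rule base_cong[OF assms(1)]) (use fv fa in \<open>auto simp: s0_def\<close>)
    let ?u1 = "setv vU (Suc i) u"
    have b1: "base ?u1" by (rule base_cong[OF bu]) auto
    define u2 where "u2 = exec code_com ?u1"
    have u2: "base u2" unfolding u2_def using b1 by (intro base_exec) simp_all
    have "snd u aWt = snd s aWt" using fa[of aWt] by (simp add: s0_def)
    then have u2_code: "fst u2 vCode = cd i"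
      using exec_code[OF b1 i] P by (simp add: u2_def cd_def)
    have u2_eq: "fst u2 vU = Suc i" "fst u2 vB = 5 + i * m" "fst u2 vNum = fst u vNum" "snd u2 = snd u"
      using P by (auto simp: u2_def frame_var frame_arr)
    define v where "v = exec ?tail u2"
    have body: "exec ?body u = v" unfolding v_def u2_def
      using P bu by (simp add: base_simps)
    have Cnt: "snd u aCnt x = card (cls (weight u) i x)" for x using P by blast
    have vU: "fst v vU = Suc i" "fst v vB = 5 + Suc i * m"
      using u2_eq base_simps[OF u2] by (auto simp: v_def)
    have "?P (Suc i) v"
    proof (cases "snd u aCnt (cd i) < R")
      case True
      have v: "fst v vNum = 2 * fst u vNum" "snd v aCnt = (snd u aCnt)(cd i := Suc (snd u aCnt (cd i)))"
        "weight v = (weight u)(i := fst u vNum)"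
        using True u2_code u2_eq base_simps[OF u2] by (auto simp: v_def weight_def fun_eq_iff)
      have num: "fst u vNum = Suc (\<Sum>j<i. weight u j)" using P by blast
      have sums: "(\<Sum>j<i. weight v j) = (\<Sum>j<i. weight u j)" by (intro sum.cong) (auto simp: v)
      have "superincreasing (weight v) i"
        using P by (subst superincreasing_cong[of i _ "weight u"]) (auto simp: v)
      moreover have vi: "weight v i = Suc (\<Sum>j<i. weight v j)" unfolding sums by (simp add: v num)
      moreover have "fst v vNum = Suc (\<Sum>j<Suc i. weight v j)"
        by (simp add: vi sums) (simp add: v num)
      moreover have "cls (weight v) (Suc i) x =
          (if x = cd i then insert i (cls (weight u) i x) else cls (weight u) i x)" for x
        by (auto simp: cls_def v num less_Suc_eq)
      then have "card (cls (weight v) (Suc i) x) = snd v aCnt x" for x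
        using fin by (simp add: v Cnt) (simp add: cls_def)
      moreover have "snd v aCnt x \<le> R" for x using P True by (auto simp: v)
      moreover have "weight v j \<noteq> 0 \<or> R \<le> snd v aCnt (cd j)" if "j < Suc i" for j
        using P that by (auto simp: v num less_Suc_eq)
      moreover have "\<forall>j\<ge>Suc i. weight v j = 0" using P by (auto simp: v)
      ultimately show ?thesis using vU unfolding superincreasing_Suc by auto
    next
      case False
      have v: "fst v vNum = fst u vNum" "snd v aCnt = snd u aCnt" "weight v = weight u"
        using False u2_code u2_eq base_simps[OF u2] by (auto simp: v_def weight_def fun_eq_iff)
      have wi: "weight u i = 0" using P by simp
      then have "cls (weight u) (Suc i) x = cls (weight u) i x" for x
        by (auto simp: cls_def less_Suc_eq)
      then show ?thesis using P False vU wi unfolding v superincreasing_Suc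
        by (auto simp: less_Suc_eq not_less)
    qed
    then show "?P (Suc i) (setv vI (n - Suc i) (exec ?body u))"
      unfolding body by auto
  qed simp
  have eq: "exec keep_com s = exec (Loop vI vN ?body) s0"
    by (simp add: keep_com_def s0_def)
  have P: "?P n (exec keep_com s)" unfolding eq by (rule loop)
  then show "superincreasing W n" "fst (exec keep_com s) vNum = Suc (\<Sum>j<n. W j)"
    by (simp_all add: W_def)
  have Cnt: "snd (exec keep_com s) aCnt x = card (cls W n x)" for x using P unfolding W_def by blast
  show "W i \<noteq> 0 \<or> R \<le> card {j. j < n \<and> W j \<noteq> 0 \<and> cd j = cd i}" if "i < n" for i
    using P that Cnt unfolding W_def cls_def by metis
  show "card {j. j < n \<and> W j \<noteq> 0 \<and> cd j = u} \<le> R" for u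
    using P Cnt unfolding W_def cls_def by metis
qed

lemma exec_check:
  assumes "base s"
  shows "fst (exec check_com s) vOk =
    (if fst s vD \<le> R \<and> (\<forall>c<m. c \<noteq> p \<longrightarrow> snd s aS c < snd s aS p) then 1 else 0)"
proof -
  let ?body = "Sub vT vC vP ;; Sub vU vP vC ;; Add vT vT vU ;;
        Cond vT
          (Get vT aS vC ;; Add vT vT vOne ;; Sub vT vT vSP ;; Cond vT (Const vOk 0) Skip)
          Skip ;;
        Add vC vC vOne"
  define s0 where "s0 = exec (Const vOk 1 ;; Sub vT vD vR ;; Cond vT (Const vOk 0) Skip ;;
     Get vSP aS vP ;; Const vC 0) s"
  have s0: "fst s0 vOk = (if fst s vD \<le> R then 1 else 0)" "fst s0 vSP = snd s aS p" "fst s0 vC = 0"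
    "fst s0 vM = m" "fst s0 vP = p" "fst s0 vOne = 1" "snd s0 = snd s"
    using base_simps[OF assms] by (auto simp: s0_def)
  let ?P = "\<lambda>i u. fst u vC = i \<and> fst u vOk =
    (if fst s vD \<le> R \<and> (\<forall>c<i. c \<noteq> p \<longrightarrow> snd s aS c < snd s aS p) then 1 else 0)"
  have "?P m (exec (Loop vI vM ?body) s0)"
  proof (rule Loop_invariant[where P = ?P])
    fix i u
    assume P: "?P i u"
      and fv: "\<And>v. v \<notin> insert vI (wvars ?body) \<Longrightarrow> fst u v = fst s0 v"
      and fa: "\<And>j. j \<notin> warrs ?body \<Longrightarrow> snd u j = snd s0 j"
    have "fst u vP = p" "fst u vOne = 1" "fst u vSP = snd s aS p" "snd u aS = snd s aS"
      using fv[of vP] fv[of vOne] fv[of vSP] fa[of aS] s0 by simp_all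
    then show "?P (Suc i) (setv vI (m - Suc i) (exec ?body u))"
      using P by (auto simp: less_Suc_eq not_less)
  qed (use s0 in auto)
  moreover have "exec check_com s = exec (Loop vI vM ?body) s0"
    by (simp add: check_com_def s0_def)
  ultimately show ?thesis by simp
qed

lemma exec_search:
  assumes "base s" "fst s vOut = 0" "fst s vNum = N"
  shows "fst (exec search_com s) vOut =
    (if \<exists>x<N. card (greedy (weight s) n x) \<le> R \<and> wins tp n m p (greedy (weight s) n x) then 1 else 0)"
proof -
  let ?good = "\<lambda>x. card (greedy (weight s) n x) \<le> R \<and> wins tp n m p (greedy (weight s) n x)"
  let ?P = "\<lambda>i u. fst u vX = i \<and> fst u vOut = (if \<exists>x<i. ?good x then 1 else 0)"
  have "?P N (exec (Loop vZ vNum try_com) (setv vX 0 s))"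
  proof (rule Loop_invariant[where P = ?P])
    fix i u
    assume P: "?P i u"
      and fv: "\<And>v. v \<notin> insert vZ (wvars try_com) \<Longrightarrow> fst u v = fst (setv vX 0 s) v"
      and fa: "\<And>j. j \<notin> warrs try_com \<Longrightarrow> snd u j = snd (setv vX 0 s) j"
    define u1 where "u1 = setv vY i u"
    define u2 where "u2 = exec score_com u1"
    define u3 where "u3 = exec check_com u2"
    have bu: "base u"
      by (rule base_cong[OF assms(1)]) (use fv fa in auto)
    have b1: "base u1" unfolding u1_def by (rule base_cong[OF bu]) auto
    have b2: "base u2" unfolding u2_def using b1 by (intro base_exec) simp_all
    have b3: "base u3" unfolding u3_def using b2 by (intro base_exec) simp_all
    have "weight u1 = weight s" using fa[of aW] by (simp add: u1_def weight_def fun_eq_iff)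
    then have "fst u2 vD = card (greedy (weight s) n i)"
      "\<And>c. c < m \<Longrightarrow> snd u2 aS c = remaining tp n (greedy (weight s) n i) c"
      using exec_score[OF b1] by (simp_all add: u2_def u1_def)
    then have ok: "fst u3 vOk = (if ?good i then 1 else 0)"
      using exec_check[OF b2] p_less by (auto simp: u3_def wins_def)
    have "fst u3 vX = i" "fst u3 vOut = fst u vOut"
      using P by (simp_all add: u3_def u2_def u1_def frame_var)
    moreover have "exec try_com u = exec (Cond vOk (Const vOut 1) Skip ;; Add vX vX vOne) u3"
      using P bu by (simp add: try_com_def u1_def u2_def u3_def base_simps)
    ultimately show "?P (Suc i) (setv vZ (N - Suc i) (exec try_com u))"
      using P ok b3 by (auto simp: less_Suc_eq base_simps)
  qed (use assms in auto)
  then show ?thesis by (simp add: search_com_def)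
qed

definition num_bound :: nat where
  "num_bound = 2 ^ (R * 2 ^ (r * R + 1))"

lemma exec_end: "fst s vN = n \<Longrightarrow> fst s vM = m \<Longrightarrow> fst (exec end_com s) vEnd = 5 + n * m"
proof -
  assume "fst s vN = n" "fst s vM = m"
  then have "(\<lambda>i u. fst u vEnd = 5 + i * m) n (exec (Loop vI vN (Add vEnd vEnd vM)) (setv vEnd 5 s))"
    by (intro Loop_invariant[where P = "\<lambda>i u. fst u vEnd = 5 + i * m"]) auto
  then show ?thesis by (simp add: end_com_def)
qed

lemma exec_kernel:
  assumes base: "base (exec end_com s)"
    and zero: "\<And>j i. 0 < j \<Longrightarrow> j < 32 \<Longrightarrow> snd s j i = 0"
  defines "t \<equiv> exec (kernel_com r) s"
  shows "base t" "fst t vNum \<le> num_bound"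
    "(\<exists>x<fst t vNum. card (greedy (weight t) n x) \<le> R \<and> wins tp n m p (greedy (weight t) n x)) \<longleftrightarrow>
     r_DV r {0..<m} p (mset votes) R"
proof -
  define s1 where "s1 = setv vY 0 (exec end_com s)"
  define s2 where "s2 = exec score_com s1"
  define s3 where "s3 = exec (cap_com r) s2"
  define s4 where "s4 = exec rivals_com s3"
  have t: "t = exec keep_com s4"
    by (simp add: t_def kernel_com_def s1_def s2_def s3_def s4_def)
  have b1: "base s1" unfolding s1_def by (rule base_cong[OF base]) auto
  have b2: "base s2" unfolding s2_def using b1 by (intro base_exec) simp_all
  have b3: "base s3" unfolding s3_def using b2 by (intro base_exec) simp_all
  have b4: "base s4" unfolding s4_def using b3 by (intro base_exec) simp_all
  show "base t" unfolding t using b4 by (intro base_exec) simp_all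
  have z: "snd s j = (\<lambda>_. 0)" if "0 < j" "j < 32" for j using zero that by auto
  \<comment> \<open>All weights are still 0, so the first run of \<open>score_com\<close> deletes
    nothing and yields the original scores.\<close>
  have "weight s1 i = 0" for i by (simp add: weight_def s1_def frame_arr z)
  then have "greedy (weight s1) n y = {}" for y by (rule greedy_zero)
  then have "snd s2 aS c = remaining tp n {} c" if "c < m" for c
    using exec_score(2)[OF b1 that] by (simp add: s2_def)
  then have S: "snd s3 aS c = remaining tp n {} c" if "c < m" for c
    using that by (simp add: s3_def frame_arr)
  have Wt: "snd s3 aWt = (\<lambda>_. 0)"
    by (simp add: s3_def s2_def s1_def frame_arr z)
  have Cap: "fst s3 vCap = r * R + 1" unfolding s3_def by (rule exec_cap[OF b2])
  define wt where "wt = snd s4 aWt"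
  note rivals = exec_rivals[OF b3 S Wt Cap, folded s4_def, folded wt_def]
  have "snd s4 aW = (\<lambda>_. 0)" "snd s4 aCnt = (\<lambda>_. 0)"
    by (simp_all add: s4_def s3_def s2_def s1_def frame_arr z)
  note keep = exec_keep[OF b4 this, folded t, folded wt_def]
  define W where "W = weight t"
  have num: "fst t vNum = Suc (\<Sum>j<n. W j)" using keep(2) by (simp add: W_def)
  have "code wt i < Suc (\<Sum>c<m. wt c)" if "i < n" for i
    unfolding code_def less_Suc_eq_le using tp_subset[OF that] by (intro sum_mono2) auto
  then have "card {j. j < n \<and> W j \<noteq> 0} \<le> R * Suc (\<Sum>c<m. wt c)"
    using keep(4) by (intro card_kept_le[of n "code wt"]) (simp_all add: W_def)
  also have "\<dots> \<le> R * 2 ^ (r * R + 1)" by (intro mult_le_mono2 rivals)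
  finally have "card {j. j < n \<and> W j \<noteq> 0} \<le> R * 2 ^ (r * R + 1)" .
  then show "fst t vNum \<le> num_bound"
    unfolding num using keep(1) superincreasing_total[of W n] by (simp add: W_def num_bound_def)
  have "(\<exists>x<fst t vNum. card (greedy W n x) \<le> R \<and> wins tp n m p (greedy W n x)) \<longleftrightarrow>
      (\<exists>I. I \<subseteq> {..<n} \<and> card I \<le> R \<and> wins tp n m p I)"
  proof
    assume "\<exists>I. I \<subseteq> {..<n} \<and> card I \<le> R \<and> wins tp n m p I"
    then obtain I where I: "I \<subseteq> {..<n}" "card I \<le> R" "wins tp n m p I" by blast
    show "\<exists>x<fst t vNum. card (greedy W n x) \<le> R \<and> wins tp n m p (greedy W n x)"
      unfolding num
    proof (rule kernel_complete[OF p_less tp_subset card_tp rivals_def])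
      show "W i \<noteq> 0 \<or> R \<le> card {j. j < n \<and> W j \<noteq> 0 \<and> sum wt (tp j) = sum wt (tp i)}"
        if "i < n" for i using keep(3)[OF that] by (simp add: W_def code_def)
      show "superincreasing W n" using keep(1) by (simp add: W_def)
    qed (use rivals I in auto)
  \<comment> \<open>Soundness needs no property of the kernel: a decoded set is a set of vote
    indices, and \<open>wins\<close> refers to all votes and candidates.\<close>
  qed (use greedy_subset in blast)
  moreover have "tp = (\<lambda>i. set (take r (votes ! i)))" by (simp add: tp_def fun_eq_iff)
  ultimately show "(\<exists>x<fst t vNum. card (greedy (weight t) n x) \<le> R \<and> wins tp n m p (greedy (weight t) n x)) \<longleftrightarrow>
     r_DV r {0..<m} p (mset votes) R"
    using r_DV_iff_wins[OF p_less] by (simp add: W_def)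
qed

section \<open>The complete program on the encoded input\<close>

abbreviation input :: "nat list" where
  "input \<equiv> encode_instance m p votes R"

abbreviation input_size :: nat where
  "input_size \<equiv> length (encode_instance m p votes R)"

lemma input_size: "input_size = 4 + n * m"
proof -
  have "\<forall>v\<in>set votes. length v = m" using vote(3) by (auto simp: in_set_conv_nth)
  then show ?thesis by (simp add: encode_instance_def length_concat_const)
qed

lemma input_nth:
  assumes "i < n" "a < m"
  shows "input ! (4 + i * m + a) = votes ! i ! a"
proof -
  have "\<forall>v\<in>set votes. length v = m" using vote(3) by (auto simp: in_set_conv_nth)
  from nth_concat_const[OF this assms] show ?thesis
    by (simp add: encode_instance_def add.assoc)
qed

definition loaded :: "state \<Rightarrow> bool" where
  "loaded s \<longleftrightarrow> fst s vQ = 2 * input_size + 3 \<and>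
     (\<forall>t<4. snd s aIn (2 * input_size + t) = input ! t) \<and>
     (\<forall>a. 5 \<le> a \<and> a \<le> input_size \<longrightarrow> snd s aIn a = input ! (a - 1)) \<and>
     (\<forall>j i. 0 < j \<and> j < 32 \<longrightarrow> snd s j i = 0)"

lemma exec_header:
  assumes "loaded s"
  defines "h \<equiv> exec (header_com r) s"
  shows "fst h vOne = 1" "fst h vZero = 0" "fst h vOut = 0" "fst h vN = n" "fst h vR = R"
    "fst h vP = p" "fst h vM = m" "fst h vTop = min r m" "snd h = snd s"
proof -
  have q: "fst s vQ = 2 * input_size + 3" using assms by (simp add: loaded_def)
  have hd: "snd s aIn (2 * input_size + t) = input ! t" if "t < 4" for t
    using assms that by (simp add: loaded_def)
  have hd': "snd s aIn (2 * input_size + 3) = n" "snd s aIn (2 * input_size + 2) = R"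
    "snd s aIn (2 * input_size + Suc 0) = p"
    by (rule trans[OF hd]; simp add: encode_instance_def)+
  have hd'': "snd s aIn (2 * input_size) = m"
    using hd[of 0] by (simp add: encode_instance_def)
  show "fst h vOne = 1" "fst h vZero = 0" "fst h vOut = 0" "fst h vN = n" "fst h vR = R"
    "fst h vP = p" "fst h vM = m" "fst h vTop = min r m" "snd h = snd s"
    unfolding h_def header_com_def by (simp_all add: q hd'[simplified] hd'')
qed

lemma base_loaded:
  assumes "loaded s"
  shows "base (exec end_com (exec (header_com r) s))"
proof -
  let ?h = "exec (header_com r) s"
  note h = exec_header[OF assms]
  have "snd s aIn (5 + i * m + a) = votes ! i ! a" if "i < n" "a < m" for i a
  proof -
    have "i * m + a < Suc i * m" using that by simp
    also have "\<dots> \<le> n * m" using that by (intro mult_le_mono1) simp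
    finally have "5 + i * m + a \<le> input_size" by (simp add: input_size)
    moreover have "5 + i * m + a - 1 = 4 + i * m + a" by simp
    ultimately show ?thesis
      using assms input_nth[OF that] unfolding loaded_def by (metis le_add1 add.assoc)
  qed
  then show ?thesis
    using h exec_end[of ?h] by (simp add: base_def frame_var frame_arr)
qed

text \<open>Without votes all scores are 0, so \<open>p\<close> wins strictly only if it has no
  opponent.\<close>

lemma r_DV_no_votes:
  assumes "votes = []"
  shows "r_DV r {0..<m} p (mset votes) R \<longleftrightarrow> m = 1"
proof -
  have tp: "tp = (\<lambda>i. set (take r (votes ! i)))" by (simp add: tp_def fun_eq_iff)
  have n: "n = 0" using assms by simp
  have "r_DV r {0..<m} p (mset votes) R \<longleftrightarrow> wins tp 0 m p {}"
    unfolding r_DV_iff_wins[OF p_less tp, unfolded n] by auto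
  also have "\<dots> \<longleftrightarrow> (\<forall>c<m. c = p)" by (auto simp: wins_def remaining_def)
  also have "\<dots> \<longleftrightarrow> m = 1"
  proof
    assume eq: "\<forall>c<m. c = p"
    show "m = 1"
    proof (rule ccontr)
      assume "m \<noteq> 1"
      then have "0 < m" "1 < m" using p_less by auto
      then have "0 = p" "1 = p" using eq by blast+
      then show False by simp
    qed
  qed (use p_less in auto)
  finally show ?thesis .
qed

lemma exec_main:
  assumes "loaded s"
  shows "fst (exec (main_com r) s) vOut = (if r_DV r {0..<m} p (mset votes) R then 1 else 0)"
proof -
  let ?h = "exec (header_com r) s"
  note h = exec_header[OF assms]
  show ?thesis
  proof (cases "n = 0")
    case True
    then show ?thesis using h p_less r_DV_no_votes by (auto simp: main_com_def)
  next
    case False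
    let ?t = "exec (kernel_com r) ?h"
    have "snd ?h j i = 0" if "0 < j" "j < 32" for j i using assms that h(9) by (simp add: loaded_def)
    note k = exec_kernel[OF base_loaded[OF assms] this]
    have "fst ?t vOut = 0" using h(3) by (simp add: frame_var)
    from exec_search[OF k(1) this refl] k(3) False h(4) show ?thesis
      by (simp add: main_com_def)
  qed
qed

text \<open>Relocation is linear in the input length, the kernel quadratic, and each of at most
  \<open>num_bound\<close> trials quadratic. Since \<open>1 \<le> num_bound\<close>, everything fits
  under one multiple of \<open>num_bound * input_size ^ 2\<close>.\<close>

lemma cost_main:
  assumes "loaded s"
  shows "34 * input_size - 3 + cost (main_com r) s \<le> num_bound * input_size ^ 8"
proof -
  let ?L = input_size
  let ?h = "exec (header_com r) s"
  note h = exec_header[OF assms]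
  have L: "4 \<le> ?L" by (simp add: input_size)
  then have L1: "1 \<le> ?L" by linarith
  have B1: "1 \<le> num_bound" by (simp add: num_bound_def)
  have header: "cost (header_com r) s = 41" by (simp add: header_com_def)
  have "cost (main_com r) s \<le> 50 + 1000 * ?L ^ 2 + num_bound * (1000 * ?L ^ 2)"
  proof (cases "n = 0")
    case True
    then show ?thesis using h header by (auto simp: main_com_def)
  next
    case False
    let ?t = "exec (kernel_com r) ?h"
    \<comment> \<open>Only with at least one vote does the product \<open>n * m\<close>, and hence
      the input length, bound the number of candidates.\<close>
    have "1 \<le> n" "1 \<le> m" using False p_less by linarith+
    then have small: "m \<le> ?L" "n \<le> ?L"
      using mult_le_mono1[of 1 n m] mult_le_mono2[of 1 m n] unfolding input_size by linarith+
    then have "min r m \<le> ?L" "R \<le> ?L" using R_le by auto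
    note small = small this
    have "snd ?h j i = 0" if "0 < j" "j < 32" for j i using assms that h(9) by (simp add: loaded_def)
    note k = exec_kernel[OF base_loaded[OF assms] this]
    have "cost (kernel_com r) ?h \<le> cost_bound (kernel_com r) (fst ?h)"
      by (intro cost_le_cost_bound) auto
    also have "\<dots> \<le> cost_bound (kernel_com r) (\<lambda>_. ?L)"
      using small h by (intro cost_bound_mono) auto
    also have "\<dots> \<le> 1000 * ?L ^ 2" by (rule cost_bound_kernel[OF L1])
    finally have kernel: "cost (kernel_com r) ?h \<le> 1000 * ?L ^ 2" .
    have "cost_bound try_com (fst ?t) \<le> cost_bound try_com (\<lambda>_. ?L)"
      using small base_simps[OF k(1)] by (intro cost_bound_mono) auto
    then have trial: "4 + cost_bound try_com (fst ?t) \<le> 1000 * ?L ^ 2"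
      using cost_bound_try[OF L1] by linarith
    have "cost search_com ?t \<le> cost_bound search_com (fst ?t)"
      by (intro cost_le_cost_bound) auto
    also have "\<dots> = 4 + fst ?t vNum * (4 + cost_bound try_com (fst ?t))"
      by (simp add: search_com_def)
    also have "\<dots> \<le> 4 + num_bound * (1000 * ?L ^ 2)"
      using trial k(2) by (intro add_left_mono mult_le_mono)
    finally have "cost search_com ?t \<le> 4 + num_bound * (1000 * ?L ^ 2)" .
    then show ?thesis using kernel False h(4) by (simp add: main_com_def header)
  qed
  moreover have "1000 * ?L ^ 2 \<le> num_bound * (1000 * ?L ^ 2)" using B1 by simp
  moreover have "34 * ?L + 50 \<le> num_bound * (50 * ?L ^ 2)"
  proof -
    have "34 * ?L + 50 \<le> 50 * (?L * ?L)"
    proof -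
      have "4 * ?L \<le> ?L * ?L" using L by (intro mult_le_mono1)
      then show ?thesis using L by linarith
    qed
    also have "\<dots> = 1 * (50 * ?L ^ 2)" by (simp add: power2_eq_square)
    also have "\<dots> \<le> num_bound * (50 * ?L ^ 2)" using B1 by (rule mult_le_mono1)
    finally show ?thesis .
  qed
  moreover have "num_bound * (k * ?L ^ 2) = k * (num_bound * ?L ^ 2)" for k by simp
  ultimately have "34 * ?L - 3 + cost (main_com r) s \<le> num_bound * (2050 * ?L ^ 2)"
    by linarith
  also have "2050 * ?L ^ 2 \<le> ?L ^ 6 * ?L ^ 2"
  proof (intro mult_le_mono1)
    \<comment> \<open>The constant 2050 = 1000 + 1000 + 50 is absorbed by six further factors
      \<open>input_size\<close>, each at least 4; this is where the exponent 8 comes from.\<close>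
    have "(2050::nat) \<le> 4 ^ 6" by simp
    also have "\<dots> \<le> ?L ^ 6" by (rule power_mono[OF L]) simp
    finally show "2050 \<le> ?L ^ 6" .
  qed
  also have "?L ^ 6 * ?L ^ 2 = ?L ^ 8" by (simp add: power_add[symmetric])
  finally show ?thesis by simp
qed

lemma program_correct:
  "\<exists>t \<le> num_bound * input_size ^ 8.
     halts_with (setup_code @ compile (main_com r) 28) input t
       (if r_DV r {0..<m} p (mset votes) R then 1 else 0)"
proof -
  have "4 \<le> input_size" by (simp add: input_size)
  from setup_correct[OF refl this, of "compile (main_com r) 28"] obtain s M where
    M: "runs (setup_code @ compile (main_com r) 28) (init_config input) (34 * input_size - 3) (28, M)"
      "rel s M" and s: "loaded s"
    unfolding loaded_def by blast
  have "halts_with (setup_code @ compile (main_com r) 28) input (34 * input_size - 3 + cost (main_com r) s)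
      (fst (exec (main_com r) s) 0)"
    using halts_with_compile[of setup_code "main_com r" input] M wf_main by simp
  then show ?thesis using cost_main[OF s] exec_main[OF s] by auto
qed

end

theorem theorem6:
  fixes r :: nat
  assumes "r \<ge> 1"
  shows "r_DV_FPT r"
  unfolding r_DV_FPT_def
proof (rule exI[of _ "setup_code @ compile (main_com r) 28"],
    rule exI[of _ "\<lambda>k. 2 ^ (k * 2 ^ (r * k + 1))"], rule exI[of _ 8], intro conjI allI impI)
  show "computable_fun (\<lambda>k. 2 ^ (k * 2 ^ (r * k + 1)))" by (rule computable_subset_bound)
  fix m p R :: nat and votes :: "nat list list"
  assume "valid_instance m p votes R"
  then interpret instance_data r m p R votes by unfold_locales
  show "\<exists>t \<le> 2 ^ (R * 2 ^ (r * R + 1)) * length (encode_instance m p votes R) ^ 8.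
     halts_with (setup_code @ compile (main_com r) 28) (encode_instance m p votes R) t
       (if r_DV r {0..<m} p (mset votes) R then 1 else 0)"
    using program_correct by (simp only: num_bound_def)
qed

end
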